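(* Let $f$ be a discrete Morse-Bott function on a Lefschetz complex $\mathbb{K}$. There exists a Lefschetz complex $\mathbb{E}$, constructed recursively from $(\mathbb{K},f)$ by applying finitely many Moves in each dimension (in the precise sense given in the context), such that $\mathbb{E}$ is a disjoint union of elementary blocks and $R_t(\mathbb{K},f)=R_t(\mathbb{E},\dim)$.
   Context: A Lefschetz complex is a triple $\mathbb{K}=(X,\dim,w)$, where $X$ is a set (of cells), $\dim\colon X\to\mathbb{Z}_{\ge0}$ and $w\colon X\times X\to\mathbb{R}$ are functions, $\dim^{-1}(k)$ is finite for every $k$, and: (L1) $w(\tau,\sigma)\neq0$ implies $\dim\tau-\dim\sigma=1$; (L2) $\sum_{\sigma\in X}w(\tau,\sigma)w(\sigma,\nu)=0$ for all $\tau,\nu\in X$. A cell of dimension $k$ is a $k$-cell. The disjoint union of Lefschetz complexes has as cells the disjoint union of the cells, the given dimension and incidence functions on each summand, and incidence number $0$ between cells of distinct summands; it is a Lefschetz complex provided it has finitely many cells in each dimension. A function on $\mathbb{K}$ is a real function whose domain contains $X$; it is also regarded as a function on complexes with smaller cell sets by restriction. For functions $g$ on $\mathbb{K}_1$ and $h$ on $\mathbb{K}_2$, $g\sqcup h$ is the function on $\mathbb{K}_1\sqcup\mathbb{K}_2$ restricting to $g$ and $h$. $C_k(\mathbb{K})$ is the real vector space with basis the $k$-cells, $\partial_k(\tau)=\sum_\sigma w(\tau,\sigma)\sigma$ for a $k$-cell $\tau$ (sum over $(k-1)$-cells), $B_k(\mathbb{K})=\operatorname{im}\partial_{k+1}$.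 For $f\colon\mathbb{K}\to\mathbb{R}$ put $U^{\mathrm{snc}}(\sigma)=\#\{\tau\mid w(\tau,\sigma)\ne0,\ f(\sigma)>f(\tau)\}$, $D^{\mathrm{snc}}(\sigma)=\#\{\nu\mid w(\sigma,\nu)\ne0,\ f(\sigma)<f(\nu)\}$. $f$ is discrete Morse-Bott if $U^{\mathrm{snc}}(\sigma)\le1$ and $D^{\mathrm{snc}}(\sigma)\le1$ for all $\sigma$. A cell is weakly critical if $U^{\mathrm{snc}}(\sigma)+D^{\mathrm{snc}}(\sigma)=0$. The weakly critical complex $\mathbb{W}(\mathbb{K},f)$ is the Lefschetz complex whose cells are the weakly critical cells, with the restricted dimension function and with incidence function $w(\tau,\sigma)$ if $f(\tau)=f(\sigma)$ and $0$ otherwise. With $d_k^{\mathrm{snc}}(\mathbb{K},f)=\#\{k\text{-cells }\sigma\mid D^{\mathrm{snc}}(\sigma)=1\}$, $$R_t(\mathbb{K},f)=\sum_{k=1}^\infty\bigl(\operatorname{rank}B_{k-1}(\mathbb{K})-d_k^{\mathrm{snc}}(\mathbb{K},f)-\operatorname{rank}B_{k-1}(\mathbb{W}(\mathbb{K},f))\bigr)t^{k-1}.$$ The function $\dim$ is always discrete Morse-Bott. Elementary block: for cells $\mu,\kappa$ with $\dim\mu-\dim\kappa=1$, $E(\mu,\kappa)$ is the Lefschetz complex with exactly the two cells $\mu,\kappa$ (same dimensions), incidence number $1$ at $(\mu,\kappa)$ and $0$ at all other pairs. Cancellation: for $\mu,\kappa\in\mathbb{K}$ with $w(\mu,\kappa)\ne0$,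 $\mathbb{K}\{\mu,\kappa\}$ is the Lefschetz complex with cells $X\setminus\{\mu,\kappa\}$, restricted dimension function, and incidence function $w'(\tau,\sigma)=w(\tau,\sigma)-w(\tau,\kappa)w(\mu,\sigma)/w(\mu,\kappa)$. Moves, applied to a pair $(\mathbb{K},f)$ with $f$ discrete Morse-Bott on $\mathbb{K}$ (each yields again such a pair): Move (I): if $w(\mu,\kappa)\ne0$ and either (a) $f(\mu)<f(\kappa)$, or (b) $\mu,\kappa$ are weakly critical and $f(\mu)=f(\kappa)$, replace $(\mathbb{K},f)$ by $(\mathbb{K}\{\mu,\kappa\},f)$. Move (II): if $\eta$ is an isolated cell, i.e. $w(\sigma,\eta)=w(\eta,\sigma)=0$ for all $\sigma\in\mathbb{K}$, remove $\eta$ (restricting $\dim$, $w$ and $f$ to the remaining cells). Move (III): replace $f$ by a function $g\colon\mathbb{K}\to\mathbb{R}$ such that for all cells $\alpha,\beta$ with $w(\alpha,\beta)\ne0$ or $w(\beta,\alpha)\neq0$ one has $f(\alpha)<f(\beta)\iff g(\alpha)<g(\beta)$. Move (IV): if $w(\mu,\kappa)\ne0$ and $f(\sigma)=\dim\sigma$ for every cell $\sigma$ of $\mathbb{K}$ of dimension $\dim\mu$ or $\dim\kappa$, replace $(\mathbb{K},f)$ by $(\mathbb{K}\{\mu,\kappa\}\sqcup E(\mu,\kappa),f)$. Recursive construction: $\mathbb{E}$ is said to be constructed recursively from $(\mathbb{K},f)$ by applying finitely many Moves in each dimension if there are, for $n\in\mathbb{Z}_{\ge0}$, Lefschetz complexes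 $\mathbb{E}_n$ with finitely many cells that are disjoint unions of elementary blocks, Lefschetz complexes $\mathbb{M}_n$ all of whose cells have dimension at least $n$, and discrete Morse-Bott functions $f_n$ on $\mathbb{M}_n$, such that $\mathbb{E}_0=\emptyset$, $\mathbb{M}_0=\mathbb{K}$, $f_0=f$; for every $n$, $\mathbb{E}_n$ is contained in $\mathbb{E}_{n+1}$ as a subcomplex (with the restricted dimension and incidence functions) and every cell of $\mathbb{E}_{n+1}\setminus\mathbb{E}_n$ has dimension $n$ or $n+1$; for every $n$, the pair $(\mathbb{E}_{n+1}\sqcup\mathbb{M}_{n+1},\dim\sqcup f_{n+1})$ is obtained from $(\mathbb{E}_n\sqcup\mathbb{M}_n,\dim\sqcup f_n)$ by finitely many Moves; and $\mathbb{E}=\bigcup_{n\ge0}\mathbb{E}_n$. *)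

theory Defs
  imports "HOL-Analysis.Analysis" "HOL-Analysis.Finite_Function_Topology" "HOL-Computational_Algebra.Formal_Power_Series"
begin

(* Dimension and incidence are total functions; only their values on the set of cells
   are meaningful.  Two records describe the same complex iff they agree there (same_complex). *)

record 'a complex_data =
  cells :: "'a set"
  cdim :: "'a \<Rightarrow> nat"
  incidence :: "'a \<Rightarrow> 'a \<Rightarrow> real"

definition kcells :: "'a complex_data \<Rightarrow> nat \<Rightarrow> 'a set" where
  "kcells K k = {\<sigma> \<in> cells K. cdim K \<sigma> = k}"

(* In the last clause the sum is restricted to its support, which is finite by the first
   two clauses: a plain sum over an infinite set of cells would be 0 by convention. *)
definition lefschetz_complex :: "'a complex_data \<Rightarrow> bool" where
  "lefschetz_complex K \<longleftrightarrow>
     (\<forall>k. finite (kcells K k)) \<and>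
     (\<forall>\<tau>\<in>cells K. \<forall>\<sigma>\<in>cells K. incidence K \<tau> \<sigma> \<noteq> 0 \<longrightarrow> cdim K \<tau> = cdim K \<sigma> + 1) \<and>
     (\<forall>\<tau>\<in>cells K. \<forall>\<nu>\<in>cells K.
        (\<Sum>\<sigma> \<in> {\<sigma> \<in> cells K. incidence K \<tau> \<sigma> \<noteq> 0}. incidence K \<tau> \<sigma> * incidence K \<sigma> \<nu>) = 0)"

definition subcomplex :: "'a complex_data \<Rightarrow> 'a complex_data \<Rightarrow> bool" where
  "subcomplex L K \<longleftrightarrow>
     cells L \<subseteq> cells K \<and>
     (\<forall>\<sigma>\<in>cells L. cdim L \<sigma> = cdim K \<sigma>) \<and>
     (\<forall>\<tau>\<in>cells L. \<forall>\<sigma>\<in>cells L. incidence L \<tau> \<sigma> = incidence K \<tau> \<sigma>)"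

definition same_complex :: "'a complex_data \<Rightarrow> 'a complex_data \<Rightarrow> bool" where
  "same_complex K L \<longleftrightarrow> cells K = cells L \<and> subcomplex K L"

(* Disjoint unions are internal: they are only used for summands with disjoint cell sets. *)
definition disj_union ::
  "'a complex_data \<Rightarrow> 'a complex_data \<Rightarrow> 'a complex_data" (infixl "\<squnion>\<^sub>c" 65) where
  "K \<squnion>\<^sub>c L =
     \<lparr>cells = cells K \<union> cells L,
      cdim = (\<lambda>\<sigma>. if \<sigma> \<in> cells K then cdim K \<sigma> else cdim L \<sigma>),
      incidence = (\<lambda>\<tau> \<sigma>. if \<tau> \<in> cells K \<and> \<sigma> \<in> cells K then incidence K \<tau> \<sigma>
                          else if \<tau> \<in> cells L \<and> \<sigma> \<in> cells L then incidence L \<tau> \<sigma>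
                          else 0)\<rparr>"

definition fun_union :: "'a complex_data \<Rightarrow> ('a \<Rightarrow> real) \<Rightarrow> ('a \<Rightarrow> real) \<Rightarrow> 'a \<Rightarrow> real" where
  "fun_union K g h = (\<lambda>\<sigma>. if \<sigma> \<in> cells K then g \<sigma> else h \<sigma>)"

definition is_disjoint_union ::
  "'a complex_data \<Rightarrow> 'i set \<Rightarrow> ('i \<Rightarrow> 'a complex_data) \<Rightarrow> bool" where
  "is_disjoint_union L I F \<longleftrightarrow>
     disjoint_family_on (\<lambda>i. cells (F i)) I \<and>
     cells L = (\<Union>i\<in>I. cells (F i)) \<and>
     (\<forall>i\<in>I. \<forall>\<sigma>\<in>cells (F i). cdim L \<sigma> = cdim (F i) \<sigma>) \<and>
     (\<forall>i\<in>I. \<forall>j\<in>I. \<forall>\<tau>\<in>cells (F i). \<forall>\<sigma>\<in>cells (F j).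
        incidence L \<tau> \<sigma> = (if i = j then incidence (F i) \<tau> \<sigma> else 0))"

definition elementary_block :: "('a \<Rightarrow> nat) \<Rightarrow> 'a \<Rightarrow> 'a \<Rightarrow> 'a complex_data" where
  "elementary_block d \<mu> \<kappa> =
     \<lparr>cells = {\<mu>, \<kappa>}, cdim = d,
      incidence = (\<lambda>\<tau> \<sigma>. if \<tau> = \<mu> \<and> \<sigma> = \<kappa> then 1 else 0)\<rparr>"

definition disjoint_union_of_blocks :: "'a complex_data \<Rightarrow> bool" where
  "disjoint_union_of_blocks L \<longleftrightarrow>
     (\<exists>P \<subseteq> {(\<mu>, \<kappa>). \<mu> \<in> cells L \<and> \<kappa> \<in> cells L \<and> cdim L \<mu> = cdim L \<kappa> + 1}.
        is_disjoint_union L P (\<lambda>(\<mu>, \<kappa>). elementary_block (cdim L) \<mu> \<kappa>))"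

(* The chain space is the part of the free real vector space on 'a spanned by the k-cells. *)
definition chains :: "'a complex_data \<Rightarrow> nat \<Rightarrow> ('a \<Rightarrow>\<^sub>0 real) set" where
  "chains K k = {c. Poly_Mapping.keys c \<subseteq> kcells K k}"

definition boundary_cell :: "'a complex_data \<Rightarrow> 'a \<Rightarrow> ('a \<Rightarrow>\<^sub>0 real)" where
  "boundary_cell K \<tau> =
     (\<Sum>\<sigma> \<in> {\<sigma> \<in> cells K. cdim K \<tau> = cdim K \<sigma> + 1}. Poly_Mapping.single \<sigma> (incidence K \<tau> \<sigma>))"

definition boundary :: "'a complex_data \<Rightarrow> ('a \<Rightarrow>\<^sub>0 real) \<Rightarrow> ('a \<Rightarrow>\<^sub>0 real)" where
  "boundary K c = (\<Sum>\<tau> \<in> Poly_Mapping.keys c. Poly_Mapping.lookup c \<tau> *\<^sub>R boundary_cell K \<tau>)"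

definition boundaries :: "'a complex_data \<Rightarrow> nat \<Rightarrow> ('a \<Rightarrow>\<^sub>0 real) set" where
  "boundaries K k = boundary K ` chains K (k + 1)"

definition Usnc :: "'a complex_data \<Rightarrow> ('a \<Rightarrow> real) \<Rightarrow> 'a \<Rightarrow> nat" where
  "Usnc K f \<sigma> = card {\<tau> \<in> cells K. incidence K \<tau> \<sigma> \<noteq> 0 \<and> f \<sigma> > f \<tau>}"

definition Dsnc :: "'a complex_data \<Rightarrow> ('a \<Rightarrow> real) \<Rightarrow> 'a \<Rightarrow> nat" where
  "Dsnc K f \<sigma> = card {\<nu> \<in> cells K. incidence K \<sigma> \<nu> \<noteq> 0 \<and> f \<sigma> < f \<nu>}"

definition discrete_Morse_Bott :: "'a complex_data \<Rightarrow> ('a \<Rightarrow> real) \<Rightarrow> bool" where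
  "discrete_Morse_Bott K f \<longleftrightarrow> (\<forall>\<sigma>\<in>cells K. Usnc K f \<sigma> \<le> 1 \<and> Dsnc K f \<sigma> \<le> 1)"

definition weakly_critical :: "'a complex_data \<Rightarrow> ('a \<Rightarrow> real) \<Rightarrow> 'a \<Rightarrow> bool" where
  "weakly_critical K f \<sigma> \<longleftrightarrow> \<sigma> \<in> cells K \<and> Usnc K f \<sigma> + Dsnc K f \<sigma> = 0"

definition weakly_critical_complex :: "'a complex_data \<Rightarrow> ('a \<Rightarrow> real) \<Rightarrow> 'a complex_data" where
  "weakly_critical_complex K f =
     \<lparr>cells = {\<sigma>. weakly_critical K f \<sigma>},
      cdim = cdim K,
      incidence = (\<lambda>\<tau> \<sigma>. if f \<tau> = f \<sigma> then incidence K \<tau> \<sigma> else 0)\<rparr>"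

definition dsnc :: "'a complex_data \<Rightarrow> ('a \<Rightarrow> real) \<Rightarrow> nat \<Rightarrow> nat" where
  "dsnc K f k = card {\<sigma> \<in> kcells K k. Dsnc K f \<sigma> = 1}"

(* A formal power series, since the complex need not be finite; the index j is k - 1
   in the sum over k \<ge> 1 of the terms in t^(k-1). *)
definition R_series :: "'a complex_data \<Rightarrow> ('a \<Rightarrow> real) \<Rightarrow> int fps" where
  "R_series K f = Abs_fps (\<lambda>j. int (dim (boundaries K j)) - int (dsnc K f (j + 1))
     - int (dim (boundaries (weakly_critical_complex K f) j)))"

definition dim_fun :: "'a complex_data \<Rightarrow> 'a \<Rightarrow> real" where
  "dim_fun K \<sigma> = real (cdim K \<sigma>)"

definition remove_cell :: "'a complex_data \<Rightarrow> 'a \<Rightarrow> 'a complex_data" where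
  "remove_cell K \<eta> = K\<lparr>cells := cells K - {\<eta>}\<rparr>"

definition isolated_cell :: "'a complex_data \<Rightarrow> 'a \<Rightarrow> bool" where
  "isolated_cell K \<eta> \<longleftrightarrow>
     \<eta> \<in> cells K \<and> (\<forall>\<sigma>\<in>cells K. incidence K \<sigma> \<eta> = 0 \<and> incidence K \<eta> \<sigma> = 0)"

definition cancel :: "'a complex_data \<Rightarrow> 'a \<Rightarrow> 'a \<Rightarrow> 'a complex_data" where
  "cancel K \<mu> \<kappa> =
     \<lparr>cells = cells K - {\<mu>, \<kappa>},
      cdim = cdim K,
      incidence = (\<lambda>\<tau> \<sigma>. incidence K \<tau> \<sigma>
        - incidence K \<tau> \<kappa> * incidence K \<mu> \<sigma> / incidence K \<mu> \<kappa>)\<rparr>"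

inductive elementary_move ::
  "'a complex_data \<times> ('a \<Rightarrow> real) \<Rightarrow> 'a complex_data \<times> ('a \<Rightarrow> real) \<Rightarrow> bool" where
  move_Ia:
    "\<lbrakk>\<mu> \<in> cells K; \<kappa> \<in> cells K; incidence K \<mu> \<kappa> \<noteq> 0; f \<mu> < f \<kappa>\<rbrakk>
     \<Longrightarrow> elementary_move (K, f) (cancel K \<mu> \<kappa>, f)"
| move_Ib:
    "\<lbrakk>weakly_critical K f \<mu>; weakly_critical K f \<kappa>; incidence K \<mu> \<kappa> \<noteq> 0; f \<mu> = f \<kappa>\<rbrakk>
     \<Longrightarrow> elementary_move (K, f) (cancel K \<mu> \<kappa>, f)"
| move_II:
    "isolated_cell K \<eta> \<Longrightarrow> elementary_move (K, f) (remove_cell K \<eta>, f)"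
| move_III:
    "\<lbrakk>\<And>\<alpha> \<beta>. \<lbrakk>\<alpha> \<in> cells K; \<beta> \<in> cells K; incidence K \<alpha> \<beta> \<noteq> 0 \<or> incidence K \<beta> \<alpha> \<noteq> 0\<rbrakk>
        \<Longrightarrow> f \<alpha> < f \<beta> \<longleftrightarrow> g \<alpha> < g \<beta>\<rbrakk>
     \<Longrightarrow> elementary_move (K, f) (K, g)"
| move_IV:
    "\<lbrakk>\<mu> \<in> cells K; \<kappa> \<in> cells K; incidence K \<mu> \<kappa> \<noteq> 0;
      \<forall>\<sigma>\<in>cells K. cdim K \<sigma> = cdim K \<mu> \<or> cdim K \<sigma> = cdim K \<kappa> \<longrightarrow> f \<sigma> = real (cdim K \<sigma>)\<rbrakk>
     \<Longrightarrow> elementary_move (K, f) (cancel K \<mu> \<kappa> \<squnion>\<^sub>c elementary_block (cdim K) \<mu> \<kappa>, f)"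

definition Morse_Bott_pair :: "'a complex_data \<times> ('a \<Rightarrow> real) \<Rightarrow> bool" where
  "Morse_Bott_pair p \<longleftrightarrow> lefschetz_complex (fst p) \<and> discrete_Morse_Bott (fst p) (snd p)"

definition move ::
  "'a complex_data \<times> ('a \<Rightarrow> real) \<Rightarrow> 'a complex_data \<times> ('a \<Rightarrow> real) \<Rightarrow> bool" where
  "move p q \<longleftrightarrow> Morse_Bott_pair p \<and> elementary_move p q"

(* The result of the finite sequence of moves only has to agree with q on the cells. *)
definition obtained_by_moves ::
  "'a complex_data \<times> ('a \<Rightarrow> real) \<Rightarrow> 'a complex_data \<times> ('a \<Rightarrow> real) \<Rightarrow> bool" where
  "obtained_by_moves p q \<longleftrightarrow>
     (\<exists>K f. move\<^sup>*\<^sup>* p (K, f) \<and> same_complex K (fst q) \<and> (\<forall>\<sigma>\<in>cells K. f \<sigma> = snd q \<sigma>))"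

(* Moves never introduce new cells, so all complexes can live on the same type 'a. *)
definition constructed_recursively ::
  "'a complex_data \<Rightarrow> ('a \<Rightarrow> real) \<Rightarrow> 'a complex_data \<Rightarrow> bool" where
  "constructed_recursively K f E \<longleftrightarrow>
     (\<exists>En Mn fn.
        (\<forall>n::nat. lefschetz_complex (En n) \<and> finite (cells (En n)) \<and>
                  disjoint_union_of_blocks (En n)) \<and>
        (\<forall>n. lefschetz_complex (Mn n) \<and> (\<forall>\<sigma>\<in>cells (Mn n). cdim (Mn n) \<sigma> \<ge> n)) \<and>
        (\<forall>n. discrete_Morse_Bott (Mn n) (fn n)) \<and>
        cells (En 0) = {} \<and> Mn 0 = K \<and> fn 0 = f \<and>
        (\<forall>n. subcomplex (En n) (En (Suc n))) \<and>
        (\<forall>n. \<forall>\<sigma>\<in>cells (En (Suc n)) - cells (En n). cdim (En (Suc n)) \<sigma> \<in> {n, n + 1}) \<and>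
        (\<forall>n. cells (En n) \<inter> cells (Mn n) = {}) \<and>
        (\<forall>n. obtained_by_moves
               (En n \<squnion>\<^sub>c Mn n, fun_union (En n) (dim_fun (En n)) (fn n))
               (En (Suc n) \<squnion>\<^sub>c Mn (Suc n),
                fun_union (En (Suc n)) (dim_fun (En (Suc n))) (fn (Suc n)))) \<and>
        cells E = (\<Union>n. cells (En n)) \<and> (\<forall>n. subcomplex (En n) E))"

end

theory Submission
  imports Defs
begin

text \<open>
  The remainder series compares three numbers in each degree \<open>j\<close>: the rank of the boundary map from
  dimension \<open>j + 1\<close> to \<open>j\<close>, the number of noncritical pairs there, and the rank of the corresponding
  boundary map of the weakly critical complex.  For a union of blocks with \<open>dim\<close> as its function the
  last two vanish, and the first counts the blocks whose smaller cell has dimension \<open>j\<close>.  So it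
  suffices to transform \<open>(K, f)\<close> into blocks by moves that do not change the remainder series.

  Cancellation is Gaussian elimination on the boundary matrix: it lowers the rank by one in the degree of
  the cancelled pair and, thanks to \<open>\<partial>\<partial> = 0\<close>, leaves all other ranks unchanged
  (\<open>dim_boundaries_cancel\<close>).  If the pair is noncritical, one noncritical pair is lost; if it is a
  level pair of weakly critical cells, one rank of the weakly critical complex is lost.  The remainder
  is the same in both cases (\<open>R_series_cancel\<close>).  The combinatorial reason that nothing else happens
  is that a vanishing sum \<open>\<partial>\<partial> = 0\<close> never has exactly one nonzero term
  (\<open>lefschetz_second_path\<close>).

  Suppose that \<open>f\<close> increases strictly with dimension along the incidences in degrees below \<open>k\<close>.
  When no pair in degree \<open>k\<close> can be cancelled any more, it does so in degree \<open>k\<close> as well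
  (\<open>increasing_upto_Suc_or_cancellable\<close>).  Stage \<open>n\<close> establishes this in the degrees \<open>n\<close> and \<open>n + 1\<close>.  Then \<open>f\<close> may be replaced by the dimension on
  all cells of dimension at most \<open>n + 1\<close>, pairs of incident cells of dimensions
  \<open>n + 1\<close> and \<open>n\<close> are split off as blocks one
  after the other, and the \<open>n\<close>-cells that remain are isolated and can be removed
  (\<open>partly_split_step\<close>).  A stage involves finitely many moves because each move uses up a cell of
  a fixed dimension, or is the single replacement of \<open>f\<close>.

  The blocks split off in all stages form \<open>E\<close>.  Stage \<open>m\<close> only adds blocks in degree \<open>m\<close>, so
  the coefficient of the remainder series in degree \<open>j\<close> can be read off after stage \<open>j\<close>, where it
  is the rank of the boundary map of \<open>E\<close>.

  Throughout a stage the disjoint union of the blocks and the remaining complex is kept as one complex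
  together with the set \<open>P\<close> of its block pairs (locale \<open>partly_split\<close>), since the moves act on this
  union; the two parts are separated again only at the end of a stage.
\<close>

section \<open>Rank of a rectangular block of incidence numbers\<close>

lemma lookup_scaleR:
  "Poly_Mapping.lookup (r *\<^sub>R (x :: 'a \<Rightarrow>\<^sub>0 'b::real_vector)) i = r *\<^sub>R Poly_Mapping.lookup x i"
proof -
  have "finite {i. r *\<^sub>R Poly_Mapping.lookup x i \<noteq> 0}"
    by (rule finite_subset[OF _ finite_lookup[of x]]) auto
  then show ?thesis
    by (simp add: scaleR_poly_mapping_def Abs_poly_mapping_inverse)
qed

lemma linear_lookup: "linear (\<lambda>x :: 'a \<Rightarrow>\<^sub>0 real. Poly_Mapping.lookup x i)"
  by (rule linearI) (simp_all add: lookup_add lookup_scaleR)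

lemma dim_inj_linear_image:
  fixes h :: "'v::real_vector \<Rightarrow> 'u::real_vector"
  assumes h: "linear h" and inj: "inj_on h (span S)"
  shows "dim (h ` S) = dim S"
proof -
  obtain B where B: "B \<subseteq> S" "independent B" "S \<subseteq> span B" "card B = dim S"
    using basis_exists by blast
  have span: "span B = span S"
    using B by (metis span_minimal span_mono span_span subset_antisym subspace_span)
  have "independent (h ` B)"
    using linear_independent_injective_image[OF h B(2)] inj span by simp
  moreover have "span (h ` B) = span (h ` S)"
    using linear_span_image[OF h] span by metis
  ultimately have "dim (h ` S) = card (h ` B)"
    by (metis dim_eq_card)
  moreover have "inj_on h B"
    using inj B(1) by (meson inj_on_subset span_superset subset_trans)
  ultimately show ?thesis
    using B(4) card_image by metis
qed

lemma dim_insert_notin_span: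
  fixes x :: "'v::real_vector"
  assumes "finite S" "x \<notin> span S"
  shows "dim (insert x S) = dim S + 1"
proof -
  obtain B where B: "B \<subseteq> S" "independent B" "S \<subseteq> span B" "card B = dim S"
    using basis_exists by blast
  have span: "span B = span S"
    using B by (metis span_minimal span_mono span_span subset_antisym subspace_span)
  have fin: "finite B" using B(1) assms(1) finite_subset by blast
  have x: "x \<notin> B" using assms(2) span span_base by metis
  have "independent (insert x B)"
    using B(2) assms(2) span by (simp add: independent_insertI)
  moreover have "span (insert x B) = span (insert x S)"
    using span by (simp add: span_insert)
  ultimately have "dim (insert x S) = card (insert x B)"
    by (metis dim_eq_card)
  then show ?thesis using fin x B(4) by simp
qed

definition row_vector :: "('a \<Rightarrow> 'a \<Rightarrow> real) \<Rightarrow> 'a set \<Rightarrow> 'a \<Rightarrow> ('a \<Rightarrow>\<^sub>0 real)" where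
  "row_vector w B \<tau> = (\<Sum>\<sigma>\<in>B. Poly_Mapping.single \<sigma> (w \<tau> \<sigma>))"

definition incidence_rank :: "('a \<Rightarrow> 'a \<Rightarrow> real) \<Rightarrow> 'a set \<Rightarrow> 'a set \<Rightarrow> nat" where
  "incidence_rank w A B = dim (row_vector w B ` A)"

lemma lookup_row_vector:
  "finite B \<Longrightarrow> Poly_Mapping.lookup (row_vector w B \<tau>) \<sigma> = (if \<sigma> \<in> B then w \<tau> \<sigma> else 0)"
  by (simp add: row_vector_def lookup_sum lookup_single when_def)

lemma incidence_rank_cong:
  assumes "\<And>\<tau> \<sigma>. \<tau> \<in> A \<Longrightarrow> \<sigma> \<in> B \<Longrightarrow> w \<tau> \<sigma> = w' \<tau> \<sigma>"
  shows "incidence_rank w A B = incidence_rank w' A B"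
proof -
  have "row_vector w B ` A = row_vector w' B ` A"
    using assms by (auto simp: row_vector_def intro!: image_cong sum.cong)
  then show ?thesis by (simp add: incidence_rank_def)
qed

lemma incidence_rank_zero:
  assumes "\<And>\<tau> \<sigma>. \<tau> \<in> A \<Longrightarrow> \<sigma> \<in> B \<Longrightarrow> w \<tau> \<sigma> = 0"
  shows "incidence_rank w A B = 0"
proof -
  have "row_vector w B ` A \<subseteq> {0}"
    using assms by (auto simp: row_vector_def)
  then have "span (row_vector w B ` A) = {0}"
    by (metis span_empty span_insert_0 subset_singletonD)
  then show ?thesis
    by (metis card.empty dim_eq_card_independent dim_span independent_empty incidence_rank_def span_empty)
qed

text \<open>Gaussian elimination with pivot \<open>(\<mu>, \<kappa>)\<close>: subtracting multiples of the pivot row clears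
  the pivot column, and the pivot row is then independent of the others.\<close>

lemma incidence_rank_eliminate:
  assumes fin: "finite A" "finite B" and piv: "\<mu> \<in> A" "\<kappa> \<in> B" "w \<mu> \<kappa> \<noteq> 0"
  shows "incidence_rank w A B =
    incidence_rank (\<lambda>\<tau> \<sigma>. w \<tau> \<sigma> - w \<tau> \<kappa> * w \<mu> \<sigma> / w \<mu> \<kappa>) (A - {\<mu>}) (B - {\<kappa>}) + 1"
proof -
  define w' where "w' = (\<lambda>\<tau> \<sigma>. w \<tau> \<sigma> - w \<tau> \<kappa> * w \<mu> \<sigma> / w \<mu> \<kappa>)"
  define S where "S = row_vector w' (B - {\<kappa>}) ` (A - {\<mu>})"
  let ?r = "row_vector w B"
  have row: "row_vector w' (B - {\<kappa>}) \<tau> = ?r \<tau> - (w \<tau> \<kappa> / w \<mu> \<kappa>) *\<^sub>R ?r \<mu>" for \<tau>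
    using fin piv
    by (intro poly_mapping_eqI) (auto simp: lookup_row_vector lookup_minus lookup_scaleR w'_def)
  have "span (?r ` A) = span (insert (?r \<mu>) S)"
  proof (rule subset_antisym; rule span_minimal)
    show "?r ` A \<subseteq> span (insert (?r \<mu>) S)"
    proof clarify
      fix \<tau> assume \<tau>: "\<tau> \<in> A"
      show "?r \<tau> \<in> span (insert (?r \<mu>) S)"
      proof (cases "\<tau> = \<mu>")
        case False
        then have "row_vector w' (B - {\<kappa>}) \<tau> \<in> S" using \<tau> by (simp add: S_def)
        then have "row_vector w' (B - {\<kappa>}) \<tau> + (w \<tau> \<kappa> / w \<mu> \<kappa>) *\<^sub>R ?r \<mu> \<in> span (insert (?r \<mu>) S)"
          by (intro span_add span_scale span_base) auto
        then show ?thesis by (simp add: row)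
      qed (simp add: span_base)
    qed
    show "insert (?r \<mu>) S \<subseteq> span (?r ` A)"
      using piv by (auto simp: S_def row intro!: span_diff span_scale intro: span_base)
  qed simp_all
  moreover have "?r \<mu> \<notin> span S"
  proof
    assume "?r \<mu> \<in> span S"
    moreover have "subspace {x :: 'a \<Rightarrow>\<^sub>0 real. Poly_Mapping.lookup x \<kappa> = 0}"
      by (intro linear_subspace_kernel linear_lookup)
    moreover have "S \<subseteq> {x. Poly_Mapping.lookup x \<kappa> = 0}"
      using fin by (auto simp: S_def lookup_row_vector)
    ultimately have "Poly_Mapping.lookup (?r \<mu>) \<kappa> = 0"
      using span_minimal by blast
    then show False using piv fin by (simp add: lookup_row_vector)
  qed
  moreover have "finite S" using fin by (simp add: S_def)
  ultimately have "dim (?r ` A) = dim S + 1"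
    by (metis dim_insert_notin_span dim_span)
  then show ?thesis by (simp add: incidence_rank_def S_def w'_def)
qed

text \<open>A column that is a fixed linear combination of the other columns is redundant: it is
  restored by an injective linear map applied to all rows.\<close>

lemma incidence_rank_remove_column:
  assumes fin: "finite B" and \<mu>: "\<mu> \<in> B"
    and dep: "\<And>\<tau>. \<tau> \<in> A \<Longrightarrow> w \<tau> \<mu> = (\<Sum>\<sigma>\<in>B - {\<mu>}. w \<tau> \<sigma> * c \<sigma>)"
  shows "incidence_rank w A B = incidence_rank w A (B - {\<mu>})"
proof -
  define h :: "('a \<Rightarrow>\<^sub>0 real) \<Rightarrow> ('a \<Rightarrow>\<^sub>0 real)" where
    "h x = x + Poly_Mapping.single \<mu> (\<Sum>\<sigma>\<in>B - {\<mu>}. Poly_Mapping.lookup x \<sigma> * c \<sigma>)" for x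
  have lin: "linear h"
  proof (rule linearI)
    fix x y :: "'a \<Rightarrow>\<^sub>0 real"
    show "h (x + y) = h x + h y"
      by (simp add: h_def lookup_add algebra_simps sum.distrib single_add)
  next
    fix r :: real and x :: "'a \<Rightarrow>\<^sub>0 real"
    show "h (r *\<^sub>R x) = r *\<^sub>R h x"
      by (rule poly_mapping_eqI)
        (auto simp: h_def lookup_add lookup_scaleR lookup_single when_def sum_distrib_left
          algebra_simps)
  qed
  let ?S = "row_vector w (B - {\<mu>}) ` A"
  have "row_vector w B ` A = h ` ?S"
  proof -
    have "row_vector w B \<tau> = h (row_vector w (B - {\<mu>}) \<tau>)" if "\<tau> \<in> A" for \<tau>
      using fin \<mu> dep[OF that]
      by (intro poly_mapping_eqI)
        (auto simp: h_def lookup_add lookup_row_vector lookup_single when_def)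
    then show ?thesis by (auto simp: image_image)
  qed
  moreover have "inj_on h (span ?S)"
  proof -
    have "subspace {x :: 'a \<Rightarrow>\<^sub>0 real. Poly_Mapping.lookup x \<mu> = 0}"
      by (intro linear_subspace_kernel linear_lookup)
    moreover have "?S \<subseteq> {x. Poly_Mapping.lookup x \<mu> = 0}"
      using fin by (auto simp: lookup_row_vector)
    ultimately have *: "span ?S \<subseteq> {x. Poly_Mapping.lookup x \<mu> = 0}"
      by (rule span_minimal[rotated])
    have "x = y" if "x \<in> span ?S" "y \<in> span ?S" "h x = h y" for x y
    proof (rule poly_mapping_eqI)
      fix i
      have "Poly_Mapping.lookup x \<mu> = 0" "Poly_Mapping.lookup y \<mu> = 0"
        using * that by auto
      moreover have "Poly_Mapping.lookup (h x) i = Poly_Mapping.lookup (h y) i"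
        using that by simp
      ultimately show "Poly_Mapping.lookup x i = Poly_Mapping.lookup y i"
        by (cases "i = \<mu>") (auto simp: h_def lookup_add lookup_single when_def)
    qed
    then show ?thesis by (rule inj_onI)
  qed
  ultimately show ?thesis
    by (simp add: incidence_rank_def dim_inj_linear_image[OF lin])
qed

text \<open>The coefficients \<open>c\<close> express the row of \<open>\<kappa>\<close> by the other rows.\<close>

lemma incidence_rank_remove_row:
  assumes fin: "finite A" "finite B" and \<kappa>: "\<kappa> \<in> A" "c \<kappa> \<noteq> 0"
    and dep: "\<And>\<sigma>. \<sigma> \<in> B \<Longrightarrow> (\<Sum>\<tau>\<in>A. c \<tau> * w \<tau> \<sigma>) = 0"
  shows "incidence_rank w A B = incidence_rank w (A - {\<kappa>}) B"
proof -
  let ?r = "row_vector w B"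
  have "(\<Sum>\<tau>\<in>A. c \<tau> *\<^sub>R ?r \<tau>) = 0"
  proof (rule poly_mapping_eqI)
    fix k show "Poly_Mapping.lookup (\<Sum>\<tau>\<in>A. c \<tau> *\<^sub>R ?r \<tau>) k = Poly_Mapping.lookup 0 k"
      using dep[of k] by (cases "k \<in> B") (simp_all add: lookup_sum lookup_scaleR lookup_row_vector fin)
  qed
  then have "c \<kappa> *\<^sub>R ?r \<kappa> + (\<Sum>\<tau>\<in>A - {\<kappa>}. c \<tau> *\<^sub>R ?r \<tau>) = 0"
    using fin \<kappa> by (simp add: sum.remove)
  then have "c \<kappa> *\<^sub>R ?r \<kappa> = - (\<Sum>\<tau>\<in>A - {\<kappa>}. c \<tau> *\<^sub>R ?r \<tau>)"
    by (simp add: eq_neg_iff_add_eq_0)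
  moreover have "- (\<Sum>\<tau>\<in>A - {\<kappa>}. c \<tau> *\<^sub>R ?r \<tau>) \<in> span (?r ` (A - {\<kappa>}))"
    by (intro span_neg span_sum span_scale span_base) auto
  ultimately have "(1 / c \<kappa>) *\<^sub>R c \<kappa> *\<^sub>R ?r \<kappa> \<in> span (?r ` (A - {\<kappa>}))"
    by (metis span_scale)
  then have "?r \<kappa> \<in> span (?r ` (A - {\<kappa>}))"
    using \<kappa>(2) by simp
  then have "span (insert (?r \<kappa>) (?r ` (A - {\<kappa>}))) = span (?r ` (A - {\<kappa>}))"
    by (rule span_redundant)
  moreover have "insert (?r \<kappa>) (?r ` (A - {\<kappa>})) = ?r ` A" using \<kappa> by auto
  ultimately show ?thesis
    by (metis dim_span incidence_rank_def)
qed

lemma incidence_rank_nonzero_rows: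
  assumes "A' \<subseteq> A" "\<And>\<tau> \<sigma>. \<tau> \<in> A - A' \<Longrightarrow> \<sigma> \<in> B \<Longrightarrow> w \<tau> \<sigma> = 0"
  shows "incidence_rank w A B = incidence_rank w A' B"
proof -
  have "row_vector w B \<tau> = 0" if "\<tau> \<in> A - A'" for \<tau>
    using assms(2)[OF that] by (simp add: row_vector_def)
  then have "insert 0 (row_vector w B ` A) = insert 0 (row_vector w B ` A')"
    using assms(1) by auto
  then have "span (row_vector w B ` A) = span (row_vector w B ` A')"
    by (metis span_insert_0)
  then show ?thesis unfolding incidence_rank_def by (metis dim_span)
qed

section \<open>Ranks of boundary spaces\<close>

lemma mem_kcells: "\<sigma> \<in> kcells K k \<longleftrightarrow> \<sigma> \<in> cells K \<and> cdim K \<sigma> = k"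
  by (simp add: kcells_def)

lemma boundary_cell_eq_row_vector:
  "cdim K \<tau> = k + 1 \<Longrightarrow> boundary_cell K \<tau> = row_vector (incidence K) (kcells K k) \<tau>"
  by (auto simp: boundary_cell_def row_vector_def kcells_def intro!: sum.cong)

text \<open>The image of the chain space is the row space of a finite matrix, so row and column
  operations apply to it.\<close>

lemma boundaries_eq_span:
  assumes fin: "finite (kcells K (k + 1))"
  shows "boundaries K k = span (row_vector (incidence K) (kcells K k) ` kcells K (k + 1))"
    (is "_ = span (?r ` ?A)")
proof -
  define h :: "('a \<Rightarrow>\<^sub>0 real) \<Rightarrow> ('a \<Rightarrow>\<^sub>0 real)" where
    "h c = (\<Sum>\<tau>\<in>?A. Poly_Mapping.lookup c \<tau> *\<^sub>R ?r \<tau>)" for c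
  have bd: "boundary K c = h c" if "c \<in> chains K (k + 1)" for c
  proof -
    have "boundary K c = (\<Sum>\<tau>\<in>Poly_Mapping.keys c. Poly_Mapping.lookup c \<tau> *\<^sub>R ?r \<tau>)"
      using that unfolding boundary_def chains_def
      by (intro sum.cong) (auto simp: boundary_cell_eq_row_vector kcells_def)
    also have "\<dots> = h c"
      using that fin unfolding h_def chains_def
      by (intro sum.mono_neutral_left) (auto simp: in_keys_iff)
    finally show ?thesis .
  qed
  have "linear h"
    by (rule linearI)
      (simp_all add: h_def lookup_add lookup_scaleR scaleR_add_left sum.distrib scaleR_sum_right)
  moreover have "subspace (chains K (k + 1))"
  proof -
    have "chains K (k + 1) = (\<Inter>i\<in>- ?A. {c. Poly_Mapping.lookup c i = 0})"
      by (auto simp: chains_def in_keys_iff)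
    then show ?thesis
      by (auto simp: subspace_def lookup_add lookup_scaleR)
  qed
  ultimately have sub: "subspace (h ` chains K (k + 1))"
    by (rule linear_subspace_image)
  have eq: "boundaries K k = h ` chains K (k + 1)"
    using bd by (auto simp: boundaries_def)
  show ?thesis
  proof
    show "boundaries K k \<subseteq> span (?r ` ?A)"
      unfolding eq h_def by (auto intro!: span_sum span_scale intro: span_base)
    have "?r \<tau> \<in> h ` chains K (k + 1)" if "\<tau> \<in> ?A" for \<tau>
    proof
      show "Poly_Mapping.single \<tau> 1 \<in> chains K (k + 1)" using that by (simp add: chains_def)
      have "h (Poly_Mapping.single \<tau> 1) = (\<Sum>\<tau>'\<in>?A. if \<tau> = \<tau>' then ?r \<tau>' else 0)"
        unfolding h_def by (intro sum.cong) (auto simp: lookup_single when_def)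
      then show "?r \<tau> = h (Poly_Mapping.single \<tau> 1)" using that fin by simp
    qed
    then show "span (?r ` ?A) \<subseteq> boundaries K k"
      unfolding eq by (intro span_minimal sub) auto
  qed
qed

lemma dim_boundaries:
  "finite (kcells K (k + 1)) \<Longrightarrow>
    dim (boundaries K k) = incidence_rank (incidence K) (kcells K (k + 1)) (kcells K k)"
  by (simp add: boundaries_eq_span incidence_rank_def)

section \<open>Lefschetz complexes\<close>

text \<open>Summing over all cells of one dimension, rather than over the support of one row, gives the
  relations \<open>\<partial>\<partial> = 0\<close> for different rows the same index set, so they can be combined linearly.\<close>

lemma lefschetz_complex_iff:
  "lefschetz_complex K \<longleftrightarrow>
     (\<forall>k. finite (kcells K k)) \<and>
     (\<forall>\<tau>\<in>cells K. \<forall>\<sigma>\<in>cells K. incidence K \<tau> \<sigma> \<noteq> 0 \<longrightarrow> cdim K \<tau> = cdim K \<sigma> + 1) \<and>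
     (\<forall>\<tau>\<in>cells K. \<forall>\<nu>\<in>cells K. \<forall>k. (\<Sum>\<sigma>\<in>kcells K k. incidence K \<tau> \<sigma> * incidence K \<sigma> \<nu>) = 0)"
  (is "_ \<longleftrightarrow> ?fin \<and> ?deg \<and> ?sq")
proof -
  let ?w = "incidence K"
  let ?supp = "\<lambda>\<tau>. {\<sigma> \<in> cells K. ?w \<tau> \<sigma> \<noteq> 0}"
  have "((\<Sum>\<sigma>\<in>?supp \<tau>. ?w \<tau> \<sigma> * ?w \<sigma> \<nu>) = 0) \<longleftrightarrow>
      (\<forall>k. (\<Sum>\<sigma>\<in>kcells K k. ?w \<tau> \<sigma> * ?w \<sigma> \<nu>) = 0)"
    if fin: ?fin and deg: ?deg and \<tau>: "\<tau> \<in> cells K" for \<tau> \<nu>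
  proof (cases "cdim K \<tau>")
    case 0
    then have "?w \<tau> \<sigma> = 0" if "\<sigma> \<in> cells K" for \<sigma> using deg \<tau> that by fastforce
    then show ?thesis by (simp add: mem_kcells)
  next
    case (Suc m)
    have "(\<Sum>\<sigma>\<in>?supp \<tau>. ?w \<tau> \<sigma> * ?w \<sigma> \<nu>) = (\<Sum>\<sigma>\<in>kcells K m. ?w \<tau> \<sigma> * ?w \<sigma> \<nu>)"
      using fin deg \<tau> Suc by (intro sum.mono_neutral_left) (auto simp: mem_kcells)
    moreover have "(\<Sum>\<sigma>\<in>kcells K k. ?w \<tau> \<sigma> * ?w \<sigma> \<nu>) = 0" if "k \<noteq> m" for k
      using deg \<tau> Suc that by (intro sum.neutral) (fastforce simp: mem_kcells)
    ultimately show ?thesis by metis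
  qed
  then show ?thesis unfolding lefschetz_complex_def by blast
qed

lemma kcells_subset: "kcells K k \<subseteq> cells K"
  by (auto simp: kcells_def)

lemma finite_kcells: "lefschetz_complex K \<Longrightarrow> finite (kcells K k)"
  by (simp add: lefschetz_complex_def)

lemma lefschetz_cdim:
  "lefschetz_complex K \<Longrightarrow> \<tau> \<in> cells K \<Longrightarrow> \<sigma> \<in> cells K \<Longrightarrow> incidence K \<tau> \<sigma> \<noteq> 0 \<Longrightarrow>
    cdim K \<tau> = cdim K \<sigma> + 1"
  by (simp add: lefschetz_complex_def)

lemma lefschetz_square:
  "lefschetz_complex K \<Longrightarrow> \<tau> \<in> cells K \<Longrightarrow> \<nu> \<in> cells K \<Longrightarrow>
    (\<Sum>\<sigma>\<in>kcells K k. incidence K \<tau> \<sigma> * incidence K \<sigma> \<nu>) = 0"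
  by (simp add: lefschetz_complex_iff)

text \<open>A vanishing sum cannot have exactly one nonzero term.  This is how \<open>\<partial>\<partial> = 0\<close> enters
  the combinatorics of Morse-Bott functions.\<close>

lemma lefschetz_second_path:
  assumes K: "lefschetz_complex K" and c: "\<tau> \<in> cells K" "\<sigma> \<in> cells K" "\<nu> \<in> cells K"
    and w: "incidence K \<tau> \<sigma> \<noteq> 0" "incidence K \<sigma> \<nu> \<noteq> 0"
  obtains \<sigma>' where "\<sigma>' \<in> cells K" "\<sigma>' \<noteq> \<sigma>" "incidence K \<tau> \<sigma>' \<noteq> 0" "incidence K \<sigma>' \<nu> \<noteq> 0"
proof (rule ccontr)
  assume "\<not> thesis"
  with that have zero: "incidence K \<tau> \<sigma>' * incidence K \<sigma>' \<nu> = 0"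
    if "\<sigma>' \<in> cells K" "\<sigma>' \<noteq> \<sigma>" for \<sigma>'
    using that by force
  let ?k = "cdim K \<sigma>"
  have "(\<Sum>\<sigma>'\<in>kcells K ?k. incidence K \<tau> \<sigma>' * incidence K \<sigma>' \<nu>) =
      (\<Sum>\<sigma>'\<in>{\<sigma>}. incidence K \<tau> \<sigma>' * incidence K \<sigma>' \<nu>)"
    using c zero by (intro sum.mono_neutral_right finite_kcells[OF K]) (auto simp: mem_kcells)
  then show False
    using w lefschetz_square[OF K c(1) c(3), of ?k] by simp
qed

lemma kcells_cong: "same_complex K L \<Longrightarrow> kcells K k = kcells L k"
  by (auto simp: same_complex_def subcomplex_def kcells_def)

lemma incidence_cong:
  "same_complex K L \<Longrightarrow> \<tau> \<in> cells K \<Longrightarrow> \<sigma> \<in> cells K \<Longrightarrow> incidence K \<tau> \<sigma> = incidence L \<tau> \<sigma>"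
  by (simp add: same_complex_def subcomplex_def)

lemma same_complex_cells: "same_complex K L \<Longrightarrow> cells K = cells L"
  by (simp add: same_complex_def)

lemma same_complexI:
  assumes "cells K = cells L" "\<And>\<sigma>. \<sigma> \<in> cells L \<Longrightarrow> cdim K \<sigma> = cdim L \<sigma>"
    "\<And>\<tau> \<sigma>. \<tau> \<in> cells L \<Longrightarrow> \<sigma> \<in> cells L \<Longrightarrow> incidence K \<tau> \<sigma> = incidence L \<tau> \<sigma>"
  shows "same_complex K L"
  using assms by (simp add: same_complex_def subcomplex_def)

lemma lefschetz_complex_cong:
  assumes "same_complex K L" shows "lefschetz_complex K \<longleftrightarrow> lefschetz_complex L"
proof -
  have "(\<Sum>\<sigma>\<in>kcells K k. incidence K \<tau> \<sigma> * incidence K \<sigma> \<nu>) =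
      (\<Sum>\<sigma>\<in>kcells L k. incidence L \<tau> \<sigma> * incidence L \<sigma> \<nu>)"
    if "\<tau> \<in> cells K" "\<nu> \<in> cells K" for k \<tau> \<nu>
    using that assms kcells_cong[OF assms]
    by (intro sum.cong) (auto simp: incidence_cong same_complex_cells mem_kcells)
  then show ?thesis
    using assms unfolding lefschetz_complex_iff kcells_cong[OF assms]
    by (auto simp: same_complex_def subcomplex_def)
qed

lemma dim_boundaries_cong:
  assumes "same_complex K L" "\<And>k. finite (kcells K k)"
  shows "dim (boundaries K j) = dim (boundaries L j)"
proof -
  have "incidence_rank (incidence K) (kcells K (j + 1)) (kcells K j) =
      incidence_rank (incidence L) (kcells K (j + 1)) (kcells K j)"
    by (intro incidence_rank_cong incidence_cong[OF assms(1)]) (auto simp: mem_kcells)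
  then show ?thesis
    using assms by (simp add: dim_boundaries kcells_cong[OF assms(1)])
qed

section \<open>Cancellation\<close>

lemma cells_cancel [simp]: "cells (cancel K \<mu> \<kappa>) = cells K - {\<mu>, \<kappa>}"
  and cdim_cancel [simp]: "cdim (cancel K \<mu> \<kappa>) = cdim K"
  and incidence_cancel: "incidence (cancel K \<mu> \<kappa>) \<tau> \<sigma> =
    incidence K \<tau> \<sigma> - incidence K \<tau> \<kappa> * incidence K \<mu> \<sigma> / incidence K \<mu> \<kappa>"
  by (simp_all add: cancel_def)

lemma kcells_cancel: "kcells (cancel K \<mu> \<kappa>) k = kcells K k - {\<mu>, \<kappa>}"
  by (auto simp: kcells_def)

text \<open>Expanding the product of two altered incidence numbers gives a linear combination of four
  instances of \<open>\<partial>\<partial> = 0\<close> in \<open>K\<close>; the terms at \<open>\<mu>\<close> and \<open>\<kappa>\<close> vanish because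
  cancellation clears the column of \<open>\<kappa>\<close> and the row of \<open>\<mu>\<close>.\<close>

lemma lefschetz_cancel:
  assumes K: "lefschetz_complex K" and \<mu>: "\<mu> \<in> cells K" and \<kappa>: "\<kappa> \<in> cells K"
    and w: "incidence K \<mu> \<kappa> \<noteq> 0"
  shows "lefschetz_complex (cancel K \<mu> \<kappa>)" (is "lefschetz_complex ?C")
  unfolding lefschetz_complex_iff
proof (intro conjI ballI allI impI)
  fix k show "finite (kcells ?C k)"
    using K by (simp add: kcells_cancel finite_kcells)
next
  fix \<tau> \<sigma> assume c: "\<tau> \<in> cells ?C" "\<sigma> \<in> cells ?C" and "incidence ?C \<tau> \<sigma> \<noteq> 0"
  then consider "incidence K \<tau> \<sigma> \<noteq> 0" | "incidence K \<tau> \<kappa> \<noteq> 0" "incidence K \<mu> \<sigma> \<noteq> 0"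
    by (cases "incidence K \<tau> \<sigma> = 0") (auto simp: incidence_cancel)
  then show "cdim ?C \<tau> = cdim ?C \<sigma> + 1"
  proof cases
    case 2
    then show ?thesis
      using c lefschetz_cdim[OF K _ \<kappa>, of \<tau>] lefschetz_cdim[OF K \<mu>, of \<sigma>]
        lefschetz_cdim[OF K \<mu> \<kappa> w] by simp
  qed (use c lefschetz_cdim[OF K] in auto)
next
  fix \<tau> \<nu> k assume c: "\<tau> \<in> cells ?C" "\<nu> \<in> cells ?C"
  let ?w = "incidence K" and ?v = "incidence ?C"
  have sq: "(\<Sum>\<sigma>\<in>kcells K k. ?w \<alpha> \<sigma> * ?w \<sigma> \<beta>) = 0" if "\<alpha> \<in> cells K" "\<beta> \<in> cells K" for \<alpha> \<beta>
    using lefschetz_square[OF K that] .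
  have "(\<Sum>\<sigma>\<in>kcells ?C k. ?v \<tau> \<sigma> * ?v \<sigma> \<nu>) = (\<Sum>\<sigma>\<in>kcells K k. ?v \<tau> \<sigma> * ?v \<sigma> \<nu>)"
    using w by (intro sum.mono_neutral_left)
      (auto simp: kcells_cancel finite_kcells[OF K] incidence_cancel)
  also have "\<dots> = (\<Sum>\<sigma>\<in>kcells K k. ?w \<tau> \<sigma> * ?w \<sigma> \<nu>
      - (?w \<mu> \<nu> / ?w \<mu> \<kappa>) * (?w \<tau> \<sigma> * ?w \<sigma> \<kappa>)
      - (?w \<tau> \<kappa> / ?w \<mu> \<kappa>) * (?w \<mu> \<sigma> * ?w \<sigma> \<nu>)
      + (?w \<tau> \<kappa> / ?w \<mu> \<kappa>) * (?w \<mu> \<nu> / ?w \<mu> \<kappa>) * (?w \<mu> \<sigma> * ?w \<sigma> \<kappa>))"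
    by (intro sum.cong refl) (simp add: incidence_cancel algebra_simps)
  also have "\<dots> = 0"
    using c \<mu> \<kappa> by (simp add: sum.distrib sum_subtractf sq
        flip: sum_distrib_left sum_divide_distrib)
  finally show "(\<Sum>\<sigma>\<in>kcells ?C k. ?v \<tau> \<sigma> * ?v \<sigma> \<nu>) = 0" .
qed

text \<open>In the degree of the cancelled pair, cancellation is one step of Gaussian elimination.  In
  the two neighbouring degrees it deletes a column, respectively a row, that is redundant because
  \<open>\<partial>\<partial> = 0\<close>.\<close>

lemma dim_boundaries_cancel:
  assumes K: "lefschetz_complex K" and \<mu>: "\<mu> \<in> cells K" and \<kappa>: "\<kappa> \<in> cells K"
    and w: "incidence K \<mu> \<kappa> \<noteq> 0"
  shows "dim (boundaries K j) =
    dim (boundaries (cancel K \<mu> \<kappa>) j) + (if j = cdim K \<kappa> then 1 else 0)"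
proof -
  let ?C = "cancel K \<mu> \<kappa>" and ?w = "incidence K" and ?v = "incidence (cancel K \<mu> \<kappa>)"
  let ?A = "kcells K (j + 1)" and ?B = "kcells K j"
  have d: "cdim K \<mu> = cdim K \<kappa> + 1" by (rule lefschetz_cdim[OF K \<mu> \<kappa> w])
  have fin: "finite ?A" "finite ?B" "finite (kcells ?C (j + 1))"
    using K by (simp_all add: finite_kcells kcells_cancel)
  note dims = dim_boundaries[OF fin(1)] dim_boundaries[OF fin(3)]
  have same: "?v \<tau> \<sigma> = ?w \<tau> \<sigma>" if "j \<noteq> cdim K \<kappa>" "\<tau> \<in> ?A" "\<sigma> \<in> ?B" for \<tau> \<sigma>
    using that lefschetz_cdim[OF K _ \<kappa>, of \<tau>] by (auto simp: incidence_cancel mem_kcells)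
  consider "j = cdim K \<kappa>" | "j = cdim K \<mu>" | "j + 1 = cdim K \<kappa>"
    | "j \<noteq> cdim K \<kappa>" "j \<noteq> cdim K \<mu>" "j + 1 \<noteq> cdim K \<kappa>" by blast
  then show ?thesis
  proof cases
    case 1
    then have "kcells ?C (j + 1) = ?A - {\<mu>}" "kcells ?C j = ?B - {\<kappa>}"
      using d by (auto simp: kcells_cancel mem_kcells)
    moreover have "?v = (\<lambda>\<tau> \<sigma>. ?w \<tau> \<sigma> - ?w \<tau> \<kappa> * ?w \<mu> \<sigma> / ?w \<mu> \<kappa>)"
      by (simp add: fun_eq_iff incidence_cancel)
    moreover have "\<mu> \<in> ?A" "\<kappa> \<in> ?B" using 1 d \<mu> \<kappa> by (auto simp: mem_kcells)
    ultimately show ?thesis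
      using incidence_rank_eliminate[OF fin(1,2), of \<mu> \<kappa> ?w] w 1 unfolding dims by simp
  next
    case 2
    then have "kcells ?C (j + 1) = ?A" "kcells ?C j = ?B - {\<mu>}"
      using d by (auto simp: kcells_cancel mem_kcells)
    moreover have "incidence_rank ?w ?A ?B = incidence_rank ?w ?A (?B - {\<mu>})"
    proof (rule incidence_rank_remove_column)
      show \<mu>B: "\<mu> \<in> ?B" using 2 \<mu> by (simp add: mem_kcells)
      fix \<tau> assume "\<tau> \<in> ?A"
      then have "(\<Sum>\<sigma>\<in>?B. ?w \<tau> \<sigma> * ?w \<sigma> \<kappa>) = 0"
        using lefschetz_square[OF K _ \<kappa>] by (simp add: mem_kcells)
      then have "?w \<tau> \<mu> * ?w \<mu> \<kappa> = - (\<Sum>\<sigma>\<in>?B - {\<mu>}. ?w \<tau> \<sigma> * ?w \<sigma> \<kappa>)"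
        using fin \<mu>B by (simp add: sum.remove eq_neg_iff_add_eq_0)
      then show "?w \<tau> \<mu> = (\<Sum>\<sigma>\<in>?B - {\<mu>}. ?w \<tau> \<sigma> * (- ?w \<sigma> \<kappa> / ?w \<mu> \<kappa>))"
        using w by (simp add: field_simps sum_negf flip: sum_divide_distrib)
    qed fact
    moreover have "incidence_rank ?w ?A (?B - {\<mu>}) = incidence_rank ?v ?A (?B - {\<mu>})"
      using 2 d by (intro incidence_rank_cong same[symmetric]) auto
    ultimately show ?thesis using 2 d unfolding dims by simp
  next
    case 3
    then have "kcells ?C (j + 1) = ?A - {\<kappa>}" "kcells ?C j = ?B"
      using d by (auto simp: kcells_cancel mem_kcells)
    moreover have "incidence_rank ?w ?A ?B = incidence_rank ?w (?A - {\<kappa>}) ?B"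
      using 3 \<kappa> w fin lefschetz_square[OF K \<mu>]
      by (intro incidence_rank_remove_row[where c = "?w \<mu>"]) (auto simp: mem_kcells)
    moreover have "incidence_rank ?w (?A - {\<kappa>}) ?B = incidence_rank ?v (?A - {\<kappa>}) ?B"
      using 3 d by (intro incidence_rank_cong same[symmetric]) auto
    ultimately show ?thesis using 3 d unfolding dims by simp
  next
    case 4
    then have "kcells ?C (j + 1) = ?A" "kcells ?C j = ?B"
      using d by (auto simp: kcells_cancel mem_kcells)
    moreover have "incidence_rank ?w ?A ?B = incidence_rank ?v ?A ?B"
      using 4 by (intro incidence_rank_cong same[symmetric]) auto
    ultimately show ?thesis using 4 unfolding dims by simp
  qed
qed

section \<open>Discrete Morse-Bott functions\<close>

lemma cofaces_eq:
  assumes "lefschetz_complex K" "\<sigma> \<in> kcells K k"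
  shows "{\<tau> \<in> cells K. incidence K \<tau> \<sigma> \<noteq> 0 \<and> P \<tau>} = {\<tau> \<in> kcells K (k + 1). incidence K \<tau> \<sigma> \<noteq> 0 \<and> P \<tau>}"
proof (rule Collect_cong)
  fix \<tau>
  show "\<tau> \<in> cells K \<and> incidence K \<tau> \<sigma> \<noteq> 0 \<and> P \<tau> \<longleftrightarrow> \<tau> \<in> kcells K (k + 1) \<and> incidence K \<tau> \<sigma> \<noteq> 0 \<and> P \<tau>"
    using lefschetz_cdim[OF assms(1), of \<tau> \<sigma>] assms(2) by (auto simp: kcells_def)
qed

lemma faces_eq:
  assumes "lefschetz_complex K" "\<sigma> \<in> kcells K (k + 1)"
  shows "{\<nu> \<in> cells K. incidence K \<sigma> \<nu> \<noteq> 0 \<and> P \<nu>} = {\<nu> \<in> kcells K k. incidence K \<sigma> \<nu> \<noteq> 0 \<and> P \<nu>}"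
proof (rule Collect_cong)
  fix \<nu>
  show "\<nu> \<in> cells K \<and> incidence K \<sigma> \<nu> \<noteq> 0 \<and> P \<nu> \<longleftrightarrow> \<nu> \<in> kcells K k \<and> incidence K \<sigma> \<nu> \<noteq> 0 \<and> P \<nu>"
    using lefschetz_cdim[OF assms(1), of \<sigma> \<nu>] assms(2) by (auto simp: kcells_def)
qed

lemma finite_cofaces:
  assumes "lefschetz_complex K" "\<sigma> \<in> cells K"
  shows "finite {\<tau> \<in> cells K. incidence K \<tau> \<sigma> \<noteq> 0 \<and> P \<tau>}"
  by (rule finite_subset[OF _ finite_kcells[OF assms(1), of "cdim K \<sigma> + 1"]])
    (use lefschetz_cdim[OF assms(1)] assms(2) in \<open>auto simp: mem_kcells\<close>)

lemma finite_faces: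
  assumes "lefschetz_complex K" "\<sigma> \<in> cells K"
  shows "finite {\<nu> \<in> cells K. incidence K \<sigma> \<nu> \<noteq> 0 \<and> P \<nu>}"
  by (rule finite_subset[OF _ finite_kcells[OF assms(1), of "cdim K \<sigma> - 1"]])
    (use lefschetz_cdim[OF assms(1) assms(2)] in \<open>auto simp: mem_kcells\<close>)

lemma Usnc_eq_0_iff:
  assumes "lefschetz_complex K" "\<sigma> \<in> cells K"
  shows "Usnc K f \<sigma> = 0 \<longleftrightarrow> (\<forall>\<tau>\<in>cells K. incidence K \<tau> \<sigma> \<noteq> 0 \<longrightarrow> f \<sigma> \<le> f \<tau>)"
  using finite_cofaces[OF assms] by (auto simp: Usnc_def not_less)

lemma Dsnc_eq_0_iff:
  assumes "lefschetz_complex K" "\<sigma> \<in> cells K"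
  shows "Dsnc K f \<sigma> = 0 \<longleftrightarrow> (\<forall>\<nu>\<in>cells K. incidence K \<sigma> \<nu> \<noteq> 0 \<longrightarrow> f \<nu> \<le> f \<sigma>)"
  using finite_faces[OF assms] by (auto simp: Dsnc_def not_less)

lemma weakly_critical_iff:
  assumes "lefschetz_complex K"
  shows "weakly_critical K f \<sigma> \<longleftrightarrow> \<sigma> \<in> cells K \<and>
    (\<forall>\<tau>\<in>cells K. incidence K \<tau> \<sigma> \<noteq> 0 \<longrightarrow> f \<sigma> \<le> f \<tau>) \<and>
    (\<forall>\<nu>\<in>cells K. incidence K \<sigma> \<nu> \<noteq> 0 \<longrightarrow> f \<nu> \<le> f \<sigma>)"
  using Usnc_eq_0_iff[OF assms] Dsnc_eq_0_iff[OF assms]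
  unfolding weakly_critical_def by (metis add_is_0)

lemma weakly_criticalD:
  assumes "lefschetz_complex K" "weakly_critical K f \<sigma>" "\<tau> \<in> cells K"
  shows "incidence K \<tau> \<sigma> \<noteq> 0 \<Longrightarrow> f \<sigma> \<le> f \<tau>" "incidence K \<sigma> \<tau> \<noteq> 0 \<Longrightarrow> f \<tau> \<le> f \<sigma>"
  using assms(2,3) by (simp_all add: weakly_critical_iff[OF assms(1)])

lemma discrete_Morse_Bott_iff:
  assumes "lefschetz_complex K"
  shows "discrete_Morse_Bott K f \<longleftrightarrow> (\<forall>\<sigma>\<in>cells K.
    (\<forall>\<tau>\<in>cells K. \<forall>\<tau>'\<in>cells K. incidence K \<tau> \<sigma> \<noteq> 0 \<longrightarrow> f \<tau> < f \<sigma> \<longrightarrow>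
      incidence K \<tau>' \<sigma> \<noteq> 0 \<longrightarrow> f \<tau>' < f \<sigma> \<longrightarrow> \<tau> = \<tau>') \<and>
    (\<forall>\<nu>\<in>cells K. \<forall>\<nu>'\<in>cells K. incidence K \<sigma> \<nu> \<noteq> 0 \<longrightarrow> f \<sigma> < f \<nu> \<longrightarrow>
      incidence K \<sigma> \<nu>' \<noteq> 0 \<longrightarrow> f \<sigma> < f \<nu>' \<longrightarrow> \<nu> = \<nu>'))"
proof -
  have "Usnc K f \<sigma> \<le> 1 \<longleftrightarrow> (\<forall>\<tau>\<in>cells K. \<forall>\<tau>'\<in>cells K. incidence K \<tau> \<sigma> \<noteq> 0 \<longrightarrow> f \<tau> < f \<sigma> \<longrightarrow>
      incidence K \<tau>' \<sigma> \<noteq> 0 \<longrightarrow> f \<tau>' < f \<sigma> \<longrightarrow> \<tau> = \<tau>')" if "\<sigma> \<in> cells K" for \<sigma>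
    unfolding Usnc_def One_nat_def card_le_Suc0_iff_eq[OF finite_cofaces[OF assms that]] by blast
  moreover have "Dsnc K f \<sigma> \<le> 1 \<longleftrightarrow> (\<forall>\<nu>\<in>cells K. \<forall>\<nu>'\<in>cells K. incidence K \<sigma> \<nu> \<noteq> 0 \<longrightarrow>
      f \<sigma> < f \<nu> \<longrightarrow> incidence K \<sigma> \<nu>' \<noteq> 0 \<longrightarrow> f \<sigma> < f \<nu>' \<longrightarrow> \<nu> = \<nu>')" if "\<sigma> \<in> cells K" for \<sigma>
    unfolding Dsnc_def One_nat_def card_le_Suc0_iff_eq[OF finite_faces[OF assms that]] by blast
  ultimately show ?thesis
    unfolding discrete_Morse_Bott_def by (intro ball_cong refl arg_cong2[where f = conj])
qed

lemma Morse_Bott_coface_unique: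
  assumes "lefschetz_complex K" "discrete_Morse_Bott K f" "\<sigma> \<in> cells K"
    and "\<tau> \<in> cells K" "incidence K \<tau> \<sigma> \<noteq> 0" "f \<tau> < f \<sigma>"
    and "\<tau>' \<in> cells K" "incidence K \<tau>' \<sigma> \<noteq> 0" "\<tau>' \<noteq> \<tau>"
  shows "f \<sigma> \<le> f \<tau>'"
  using assms(2-) unfolding discrete_Morse_Bott_iff[OF assms(1)] by (meson not_le)

lemma Morse_Bott_face_unique:
  assumes "lefschetz_complex K" "discrete_Morse_Bott K f" "\<sigma> \<in> cells K"
    and "\<nu> \<in> cells K" "incidence K \<sigma> \<nu> \<noteq> 0" "f \<sigma> < f \<nu>"
    and "\<nu>' \<in> cells K" "incidence K \<sigma> \<nu>' \<noteq> 0" "\<nu>' \<noteq> \<nu>"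
  shows "f \<nu>' \<le> f \<sigma>"
  using assms(2-) unfolding discrete_Morse_Bott_iff[OF assms(1)] by (meson not_le)

text \<open>No cell is the larger cell of one noncritical pair and the smaller cell of another.  If \<open>f\<close>
  increased along both incidences from \<open>\<nu>\<close> through \<open>\<mu>\<close> down to \<open>\<kappa>\<close>, the Morse-Bott bounds at
  the two ends would make the value at the middle cell of a second path at least that of \<open>\<kappa>\<close>
  and at most that of \<open>\<nu>\<close>.\<close>

lemma noncritical_pair_coface:
  assumes K: "lefschetz_complex K" and f: "discrete_Morse_Bott K f"
    and c: "\<nu> \<in> cells K" "\<mu> \<in> cells K" "\<kappa> \<in> cells K"
    and w: "incidence K \<nu> \<mu> \<noteq> 0" "incidence K \<mu> \<kappa> \<noteq> 0" and less: "f \<mu> < f \<kappa>"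
  shows "f \<mu> \<le> f \<nu>"
proof (rule ccontr)
  assume n: "\<not> f \<mu> \<le> f \<nu>"
  obtain \<sigma> where \<sigma>: "\<sigma> \<in> cells K" "\<sigma> \<noteq> \<mu>" "incidence K \<nu> \<sigma> \<noteq> 0" "incidence K \<sigma> \<kappa> \<noteq> 0"
    using lefschetz_second_path[OF K c w] .
  have "f \<kappa> \<le> f \<sigma>" using Morse_Bott_coface_unique[OF K f] c w less \<sigma> by metis
  moreover have "f \<sigma> \<le> f \<nu>" using Morse_Bott_face_unique[OF K f] c w n \<sigma> by (metis not_le)
  ultimately show False using n less by linarith
qed

lemma noncritical_pair_face:
  assumes K: "lefschetz_complex K" and f: "discrete_Morse_Bott K f"
    and c: "\<mu> \<in> cells K" "\<kappa> \<in> cells K" "\<nu> \<in> cells K"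
    and w: "incidence K \<mu> \<kappa> \<noteq> 0" "incidence K \<kappa> \<nu> \<noteq> 0" and less: "f \<mu> < f \<kappa>"
  shows "f \<nu> \<le> f \<kappa>"
proof (rule ccontr)
  assume n: "\<not> f \<nu> \<le> f \<kappa>"
  obtain \<sigma> where \<sigma>: "\<sigma> \<in> cells K" "\<sigma> \<noteq> \<kappa>" "incidence K \<mu> \<sigma> \<noteq> 0" "incidence K \<sigma> \<nu> \<noteq> 0"
    using lefschetz_second_path[OF K c w] .
  have "f \<sigma> \<le> f \<mu>" using Morse_Bott_face_unique[OF K f] c w less \<sigma> by metis
  moreover have "f \<nu> \<le> f \<sigma>" using Morse_Bott_coface_unique[OF K f] c w n \<sigma> by (metis not_le)
  ultimately show False using n less by linarith
qed

lemma discrete_Morse_Bott_subset: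
  assumes K: "lefschetz_complex K" and f: "discrete_Morse_Bott K f" and L: "lefschetz_complex L"
    and sub: "cells L \<subseteq> cells K"
    and inc: "\<And>\<tau> \<sigma>. \<tau> \<in> cells L \<Longrightarrow> \<sigma> \<in> cells L \<Longrightarrow> incidence L \<tau> \<sigma> \<noteq> 0 \<Longrightarrow> g \<tau> < g \<sigma> \<Longrightarrow>
      incidence K \<tau> \<sigma> \<noteq> 0 \<and> f \<tau> < f \<sigma>"
  shows "discrete_Morse_Bott L g"
  unfolding discrete_Morse_Bott_iff[OF L]
proof (intro ballI conjI impI)
  fix \<sigma> \<tau> \<tau>' assume c: "\<sigma> \<in> cells L" "\<tau> \<in> cells L" "\<tau>' \<in> cells L"
  show "\<tau> = \<tau>'" if "incidence L \<tau> \<sigma> \<noteq> 0" "g \<tau> < g \<sigma>" "incidence L \<tau>' \<sigma> \<noteq> 0" "g \<tau>' < g \<sigma>"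
    using that inc[OF c(2,1)] inc[OF c(3,1)] c sub Morse_Bott_coface_unique[OF K f, of \<sigma> \<tau> \<tau>']
    by force
  show "\<tau> = \<tau>'" if "incidence L \<sigma> \<tau> \<noteq> 0" "g \<sigma> < g \<tau>" "incidence L \<sigma> \<tau>' \<noteq> 0" "g \<sigma> < g \<tau>'"
    using that inc[OF c(1,2)] inc[OF c(1,3)] c sub Morse_Bott_face_unique[OF K f, of \<sigma> \<tau> \<tau>']
    by force
qed

section \<open>The weakly critical complex and the remainder series\<close>

lemma cells_weakly_critical_complex [simp]:
    "cells (weakly_critical_complex K f) = {\<sigma>. weakly_critical K f \<sigma>}"
  and cdim_weakly_critical_complex [simp]: "cdim (weakly_critical_complex K f) = cdim K"
  and incidence_weakly_critical_complex:
    "incidence (weakly_critical_complex K f) \<tau> \<sigma> = (if f \<tau> = f \<sigma> then incidence K \<tau> \<sigma> else 0)"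
  by (simp_all add: weakly_critical_complex_def)

lemma kcells_weakly_critical_complex:
  "kcells (weakly_critical_complex K f) k = {\<sigma> \<in> kcells K k. Usnc K f \<sigma> + Dsnc K f \<sigma> = 0}"
  by (auto simp: kcells_def weakly_critical_def)

lemma kcells_weakly_critical_subset:
  "kcells (weakly_critical_complex K f) k \<subseteq> kcells K k"
  by (auto simp: kcells_def weakly_critical_def)

text \<open>For weakly critical \<open>\<tau>\<close> and \<open>\<nu>\<close> on one level of \<open>f\<close>, every intermediate cell lies on that
  level, and it is weakly critical: otherwise a second path through its noncritical partner would
  give that partner two noncritical neighbours.\<close>

lemma lefschetz_weakly_critical_complex:
  assumes K: "lefschetz_complex K" and f: "discrete_Morse_Bott K f"
  shows "lefschetz_complex (weakly_critical_complex K f)" (is "lefschetz_complex ?W")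
  unfolding lefschetz_complex_iff
proof (intro conjI ballI allI impI)
  fix k show "finite (kcells ?W k)"
    by (rule finite_subset[OF kcells_weakly_critical_subset finite_kcells[OF K]])
next
  fix \<tau> \<sigma> assume "\<tau> \<in> cells ?W" "\<sigma> \<in> cells ?W" "incidence ?W \<tau> \<sigma> \<noteq> 0"
  then show "cdim ?W \<tau> = cdim ?W \<sigma> + 1"
    using lefschetz_cdim[OF K] by (auto simp: incidence_weakly_critical_complex weakly_critical_def split: if_splits)
next
  fix \<tau> \<nu> k assume "\<tau> \<in> cells ?W" "\<nu> \<in> cells ?W"
  then have wc: "weakly_critical K f \<tau>" "weakly_critical K f \<nu>" by simp_all
  then have c: "\<tau> \<in> cells K" "\<nu> \<in> cells K" by (simp_all add: weakly_critical_def)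
  have \<tau>: "f \<sigma> \<le> f \<tau>" if "\<sigma> \<in> cells K" "incidence K \<tau> \<sigma> \<noteq> 0" for \<sigma>
    using wc that by (simp add: weakly_critical_iff[OF K])
  have \<nu>: "f \<nu> \<le> f \<sigma>" if "\<sigma> \<in> cells K" "incidence K \<sigma> \<nu> \<noteq> 0" for \<sigma>
    using wc that by (simp add: weakly_critical_iff[OF K])
  show "(\<Sum>\<sigma>\<in>kcells ?W k. incidence ?W \<tau> \<sigma> * incidence ?W \<sigma> \<nu>) = 0"
  proof (cases "f \<tau> = f \<nu>")
    case False
    then show ?thesis
      by (intro sum.neutral) (auto simp: incidence_weakly_critical_complex)
  next
    case True
    have mid: "weakly_critical K f \<sigma> \<and> f \<sigma> = f \<tau>"
      if \<sigma>: "\<sigma> \<in> cells K" and w: "incidence K \<tau> \<sigma> \<noteq> 0" "incidence K \<sigma> \<nu> \<noteq> 0" for \<sigma>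
    proof -
      have eq: "f \<sigma> = f \<tau>" using \<tau>[OF \<sigma> w(1)] \<nu>[OF \<sigma> w(2)] True by simp
      have "f \<sigma> \<le> f \<alpha>" if \<alpha>: "\<alpha> \<in> cells K" "incidence K \<alpha> \<sigma> \<noteq> 0" for \<alpha>
      proof (rule ccontr)
        assume n: "\<not> f \<sigma> \<le> f \<alpha>"
        obtain \<sigma>' where \<sigma>': "\<sigma>' \<in> cells K" "\<sigma>' \<noteq> \<sigma>" "incidence K \<alpha> \<sigma>' \<noteq> 0" "incidence K \<sigma>' \<nu> \<noteq> 0"
          using lefschetz_second_path[OF K \<alpha>(1) \<sigma> c(2) \<alpha>(2) w(2)] .
        have "f \<sigma>' \<le> f \<alpha>" using Morse_Bott_face_unique[OF K f \<alpha>(1) \<sigma> \<alpha>(2)] n \<sigma>' by simp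
        then show False using \<nu>[OF \<sigma>'(1,4)] n eq True by simp
      qed
      moreover have "f \<beta> \<le> f \<sigma>" if \<beta>: "\<beta> \<in> cells K" "incidence K \<sigma> \<beta> \<noteq> 0" for \<beta>
      proof (rule ccontr)
        assume n: "\<not> f \<beta> \<le> f \<sigma>"
        obtain \<sigma>' where \<sigma>': "\<sigma>' \<in> cells K" "\<sigma>' \<noteq> \<sigma>" "incidence K \<tau> \<sigma>' \<noteq> 0" "incidence K \<sigma>' \<beta> \<noteq> 0"
          using lefschetz_second_path[OF K c(1) \<sigma> \<beta>(1) w(1) \<beta>(2)] .
        have "f \<beta> \<le> f \<sigma>'" using Morse_Bott_coface_unique[OF K f \<beta>(1) \<sigma> \<beta>(2)] n \<sigma>' by simp
        then show False using \<tau>[OF \<sigma>'(1,3)] n eq by simp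
      qed
      ultimately show ?thesis using \<sigma> eq by (simp add: weakly_critical_iff[OF K])
    qed
    have "(\<Sum>\<sigma>\<in>kcells ?W k. incidence ?W \<tau> \<sigma> * incidence ?W \<sigma> \<nu>) =
        (\<Sum>\<sigma>\<in>kcells ?W k. incidence K \<tau> \<sigma> * incidence K \<sigma> \<nu>)"
      using mid True
      by (intro sum.cong refl)
        (fastforce simp: incidence_weakly_critical_complex mem_kcells weakly_critical_def)
    also have "\<dots> = (\<Sum>\<sigma>\<in>kcells K k. incidence K \<tau> \<sigma> * incidence K \<sigma> \<nu>)"
      using mid by (intro sum.mono_neutral_left finite_kcells[OF K] kcells_weakly_critical_subset)
        (fastforce simp: mem_kcells)
    finally show ?thesis using lefschetz_square[OF K c] by simp
  qed
qed

lemma R_series_nth: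
  "fps_nth (R_series K f) j = int (dim (boundaries K j)) - int (dsnc K f (j + 1))
     - int (dim (boundaries (weakly_critical_complex K f) j))"
  by (simp add: R_series_def)

text \<open>The combinatorial invariants see \<open>f\<close> only through comparisons of incident cells.\<close>

lemma
  assumes same: "same_complex K L"
    and order: "\<And>\<alpha> \<beta>. \<alpha> \<in> cells K \<Longrightarrow> \<beta> \<in> cells K \<Longrightarrow>
      incidence K \<alpha> \<beta> \<noteq> 0 \<or> incidence K \<beta> \<alpha> \<noteq> 0 \<Longrightarrow> f \<alpha> < f \<beta> \<longleftrightarrow> g \<alpha> < g \<beta>"
  shows discrete_Morse_Bott_cong: "discrete_Morse_Bott K f \<longleftrightarrow> discrete_Morse_Bott L g"
    and R_series_cong: "lefschetz_complex K \<Longrightarrow> R_series K f = R_series L g"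
proof -
  note [simp] = same_complex_cells[OF same, symmetric] kcells_cong[OF same, symmetric]
    incidence_cong[OF same, symmetric]
  have U: "Usnc K f \<sigma> = Usnc L g \<sigma>" and D: "Dsnc K f \<sigma> = Dsnc L g \<sigma>" if "\<sigma> \<in> cells K" for \<sigma>
    unfolding Usnc_def Dsnc_def using order that by (auto intro!: arg_cong[where f = card])
  show "discrete_Morse_Bott K f \<longleftrightarrow> discrete_Morse_Bott L g"
    unfolding discrete_Morse_Bott_def using U D by simp
  assume K: "lefschetz_complex K"
  have "dsnc K f k = dsnc L g k" for k
    unfolding dsnc_def using D by (auto intro!: arg_cong[where f = card] simp: mem_kcells)
  moreover have "dim (boundaries K j) = dim (boundaries L j)" for j
    using dim_boundaries_cong[OF same finite_kcells[OF K]] .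
  moreover have "dim (boundaries (weakly_critical_complex K f) j) =
      dim (boundaries (weakly_critical_complex L g) j)" for j
  proof (rule dim_boundaries_cong)
    have wc: "weakly_critical K f \<sigma> \<longleftrightarrow> weakly_critical L g \<sigma>" for \<sigma>
      using U D by (auto simp: weakly_critical_def)
    have "f \<tau> = f \<sigma> \<longleftrightarrow> g \<tau> = g \<sigma>"
      if "\<tau> \<in> cells K" "\<sigma> \<in> cells K" "incidence K \<tau> \<sigma> \<noteq> 0" for \<tau> \<sigma>
      using order[of \<tau> \<sigma>] order[of \<sigma> \<tau>] that by (metis linorder_neq_iff)
    then show "same_complex (weakly_critical_complex K f) (weakly_critical_complex L g)"
      using same wc
      by (intro same_complexI)
        (auto simp: incidence_weakly_critical_complex weakly_critical_def same_complex_def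
          subcomplex_def)
    show "finite (kcells (weakly_critical_complex K f) k)" for k
      using finite_subset[OF kcells_weakly_critical_subset finite_kcells[OF K]] .
  qed
  ultimately show "R_series K f = R_series L g"
    by (intro fps_ext) (simp add: R_series_nth)
qed

section \<open>Cancelling a noncritical or level pair\<close>

text \<open>The hypotheses of Move (I) on the pair \<open>(\<mu>, \<kappa>)\<close>.  In both of its cases no incidence of
  \<open>\<mu>\<close> or \<open>\<kappa>\<close> with a third cell is noncritical; the first four lemmas record this.\<close>

locale cancellable_pair =
  fixes K :: "'a complex_data" and f :: "'a \<Rightarrow> real" and \<mu> \<kappa> :: 'a
  assumes lefschetz: "lefschetz_complex K" and Morse_Bott: "discrete_Morse_Bott K f"
    and \<mu>: "\<mu> \<in> cells K" and \<kappa>: "\<kappa> \<in> cells K" and incident: "incidence K \<mu> \<kappa> \<noteq> 0"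
    and noncritical_or_level: "f \<mu> < f \<kappa> \<or>
      weakly_critical K f \<mu> \<and> weakly_critical K f \<kappa> \<and> f \<mu> = f \<kappa>"
begin

lemma cofaces_\<mu>: "f \<mu> \<le> f \<tau>" if "\<tau> \<in> cells K" "incidence K \<tau> \<mu> \<noteq> 0"
  using noncritical_or_level noncritical_pair_coface[OF lefschetz Morse_Bott that(1) \<mu> \<kappa> that(2) incident]
    weakly_criticalD(1)[OF lefschetz _ that] by blast

lemma faces_\<mu>: "f \<sigma> \<le> f \<mu>" if "\<sigma> \<in> cells K" "incidence K \<mu> \<sigma> \<noteq> 0" "\<sigma> \<noteq> \<kappa>"
  using noncritical_or_level Morse_Bott_face_unique[OF lefschetz Morse_Bott \<mu> \<kappa> incident _ that]
    weakly_criticalD(2)[OF lefschetz _ that(1,2)] by blast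

lemma cofaces_\<kappa>: "f \<kappa> \<le> f \<tau>" if "\<tau> \<in> cells K" "incidence K \<tau> \<kappa> \<noteq> 0" "\<tau> \<noteq> \<mu>"
  using noncritical_or_level Morse_Bott_coface_unique[OF lefschetz Morse_Bott \<kappa> \<mu> incident _ that]
    weakly_criticalD(1)[OF lefschetz _ that(1,2)] by blast

lemma faces_\<kappa>: "f \<sigma> \<le> f \<kappa>" if "\<sigma> \<in> cells K" "incidence K \<kappa> \<sigma> \<noteq> 0"
  using noncritical_or_level noncritical_pair_face[OF lefschetz Morse_Bott \<mu> \<kappa> that(1) incident that(2)]
    weakly_criticalD(2)[OF lefschetz _ that] by blast

lemma le: "f \<mu> \<le> f \<kappa>"
  using noncritical_or_level by auto

lemma lefschetz_result: "lefschetz_complex (cancel K \<mu> \<kappa>)"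
  by (rule lefschetz_cancel[OF lefschetz \<mu> \<kappa> incident])

text \<open>An incidence number of \<open>\<tau>\<close> and \<open>\<sigma>\<close> changes only if \<open>\<tau>\<close> is a coface of \<open>\<kappa>\<close> and
  \<open>\<sigma>\<close> a face of \<open>\<mu>\<close>, and then both values are bounded by those of the pair.  So no incidence
  becomes noncritical or ceases to be so.\<close>

lemma altered_incidence:
  assumes "\<tau> \<in> cells (cancel K \<mu> \<kappa>)" "\<sigma> \<in> cells (cancel K \<mu> \<kappa>)"
    and "incidence (cancel K \<mu> \<kappa>) \<tau> \<sigma> \<noteq> incidence K \<tau> \<sigma>"
  shows "f \<kappa> \<le> f \<tau>" "f \<sigma> \<le> f \<mu>"
proof -
  have "incidence K \<tau> \<kappa> \<noteq> 0" "incidence K \<mu> \<sigma> \<noteq> 0"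
    using assms(3) by (auto simp: incidence_cancel)
  then show "f \<kappa> \<le> f \<tau>" "f \<sigma> \<le> f \<mu>"
    using assms(1,2) cofaces_\<kappa>[of \<tau>] faces_\<mu>[of \<sigma>] by auto
qed

lemma incidence_noncritical:
  "\<tau> \<in> cells (cancel K \<mu> \<kappa>) \<Longrightarrow> \<sigma> \<in> cells (cancel K \<mu> \<kappa>) \<Longrightarrow> f \<tau> < f \<sigma> \<Longrightarrow>
    incidence (cancel K \<mu> \<kappa>) \<tau> \<sigma> = incidence K \<tau> \<sigma>"
  using altered_incidence[of \<tau> \<sigma>] le by force

lemma Morse_Bott_result: "discrete_Morse_Bott (cancel K \<mu> \<kappa>) f"
  by (rule discrete_Morse_Bott_subset[OF lefschetz Morse_Bott lefschetz_result])
    (use incidence_noncritical in auto)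

lemma Usnc_cancel: "\<sigma> \<in> cells (cancel K \<mu> \<kappa>) \<Longrightarrow> Usnc (cancel K \<mu> \<kappa>) f \<sigma> = Usnc K f \<sigma>"
  and Dsnc_cancel: "\<sigma> \<in> cells (cancel K \<mu> \<kappa>) \<Longrightarrow> Dsnc (cancel K \<mu> \<kappa>) f \<sigma> = Dsnc K f \<sigma>"
proof -
  assume \<sigma>: "\<sigma> \<in> cells (cancel K \<mu> \<kappa>)"
  have "{\<tau> \<in> cells (cancel K \<mu> \<kappa>). incidence (cancel K \<mu> \<kappa>) \<tau> \<sigma> \<noteq> 0 \<and> f \<sigma> > f \<tau>} =
      {\<tau> \<in> cells K. incidence K \<tau> \<sigma> \<noteq> 0 \<and> f \<sigma> > f \<tau>}"
    using \<sigma> incidence_noncritical[OF _ \<sigma>] faces_\<mu>[of \<sigma>] faces_\<kappa>[of \<sigma>] by fastforce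
  then show "Usnc (cancel K \<mu> \<kappa>) f \<sigma> = Usnc K f \<sigma>" by (simp add: Usnc_def)
  have "{\<nu> \<in> cells (cancel K \<mu> \<kappa>). incidence (cancel K \<mu> \<kappa>) \<sigma> \<nu> \<noteq> 0 \<and> f \<sigma> < f \<nu>} =
      {\<nu> \<in> cells K. incidence K \<sigma> \<nu> \<noteq> 0 \<and> f \<sigma> < f \<nu>}"
    using \<sigma> incidence_noncritical[OF \<sigma>] cofaces_\<mu>[of \<sigma>] cofaces_\<kappa>[of \<sigma>] by fastforce
  then show "Dsnc (cancel K \<mu> \<kappa>) f \<sigma> = Dsnc K f \<sigma>" by (simp add: Dsnc_def)
qed

lemma weakly_critical_cancel:
  "weakly_critical (cancel K \<mu> \<kappa>) f \<sigma> \<longleftrightarrow> weakly_critical K f \<sigma> \<and> \<sigma> \<notin> {\<mu>, \<kappa>}"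
  using Usnc_cancel[of \<sigma>] Dsnc_cancel[of \<sigma>] by (auto simp: weakly_critical_def)

lemma dsnc_cancel:
  "dsnc K f k = dsnc (cancel K \<mu> \<kappa>) f k + (if f \<mu> < f \<kappa> \<and> k = cdim K \<mu> then 1 else 0)"
proof -
  let ?N = "{\<sigma> \<in> kcells K k. Dsnc K f \<sigma> = 1}"
    and ?N' = "{\<sigma> \<in> kcells (cancel K \<mu> \<kappa>) k. Dsnc (cancel K \<mu> \<kappa>) f \<sigma> = 1}"
  have \<kappa>0: "Dsnc K f \<kappa> = 0"
    using faces_\<kappa> by (simp add: Dsnc_eq_0_iff[OF lefschetz \<kappa>])
  have \<mu>1: "Dsnc K f \<mu> = (if f \<mu> < f \<kappa> then 1 else 0)"
  proof (cases "f \<mu> < f \<kappa>")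
    case True
    then have "Dsnc K f \<mu> \<noteq> 0" using \<kappa> incident by (auto simp: Dsnc_eq_0_iff[OF lefschetz \<mu>])
    moreover have "Dsnc K f \<mu> \<le> 1" using Morse_Bott \<mu> by (simp add: discrete_Morse_Bott_def)
    ultimately show ?thesis using True by simp
  next
    case False
    then show ?thesis using noncritical_or_level by (simp add: weakly_critical_def)
  qed
  have "?N = (if f \<mu> < f \<kappa> \<and> k = cdim K \<mu> then insert \<mu> ?N' else ?N')"
  proof (rule set_eqI)
    fix \<sigma>
    show "\<sigma> \<in> ?N \<longleftrightarrow> \<sigma> \<in> (if f \<mu> < f \<kappa> \<and> k = cdim K \<mu> then insert \<mu> ?N' else ?N')"
    proof (cases "\<sigma> \<in> {\<mu>, \<kappa>}")
      case True
      then show ?thesis using \<kappa>0 \<mu>1 \<mu> by (auto simp: kcells_cancel mem_kcells)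
    next
      case False
      then show ?thesis using Dsnc_cancel[of \<sigma>] by (auto simp: kcells_cancel mem_kcells)
    qed
  qed
  moreover have "card (insert \<mu> ?N') = card ?N' + 1"
    using finite_kcells[OF lefschetz] by (subst card_insert_disjoint) (auto simp: kcells_cancel)
  ultimately show ?thesis
    unfolding dsnc_def by (cases "f \<mu> < f \<kappa> \<and> k = cdim K \<mu>") simp_all
qed

text \<open>Cancelling a noncritical pair leaves the weakly critical complex alone, while cancelling a
  level pair of weakly critical cells cancels the same pair in it.\<close>

lemma dim_boundaries_weakly_critical_cancel:
  "dim (boundaries (weakly_critical_complex K f) j) =
    dim (boundaries (weakly_critical_complex (cancel K \<mu> \<kappa>) f) j) +
    (if f \<mu> = f \<kappa> \<and> j = cdim K \<kappa> then 1 else 0)"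
proof (cases "f \<mu> < f \<kappa>")
  case True
  have "\<not> weakly_critical K f \<mu>" "\<not> weakly_critical K f \<kappa>"
    using True \<mu> \<kappa> incident by (auto simp: weakly_critical_iff[OF lefschetz])
  then have wc: "weakly_critical (cancel K \<mu> \<kappa>) f \<sigma> \<longleftrightarrow> weakly_critical K f \<sigma>" for \<sigma>
    using weakly_critical_cancel by auto
  have "same_complex (weakly_critical_complex (cancel K \<mu> \<kappa>) f) (weakly_critical_complex K f)"
  proof (rule same_complexI)
    fix \<tau> \<sigma> assume "\<tau> \<in> cells (weakly_critical_complex K f)"
      and "\<sigma> \<in> cells (weakly_critical_complex K f)"
    then have "weakly_critical (cancel K \<mu> \<kappa>) f \<tau>" "weakly_critical (cancel K \<mu> \<kappa>) f \<sigma>"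
      using wc by simp_all
    then have "\<tau> \<in> cells (cancel K \<mu> \<kappa>)" "\<sigma> \<in> cells (cancel K \<mu> \<kappa>)"
      unfolding weakly_critical_def by blast+
    then have "incidence (cancel K \<mu> \<kappa>) \<tau> \<sigma> = incidence K \<tau> \<sigma>" if "f \<tau> = f \<sigma>"
      using altered_incidence[of \<tau> \<sigma>] True that by linarith
    then show "incidence (weakly_critical_complex (cancel K \<mu> \<kappa>) f) \<tau> \<sigma> =
        incidence (weakly_critical_complex K f) \<tau> \<sigma>"
      by (simp add: incidence_weakly_critical_complex)
  qed (use wc in auto)
  then have "dim (boundaries (weakly_critical_complex (cancel K \<mu> \<kappa>) f) j) =
      dim (boundaries (weakly_critical_complex K f) j)"
    using lefschetz_weakly_critical_complex[OF lefschetz_result Morse_Bott_result]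
    by (intro dim_boundaries_cong finite_kcells)
  then show ?thesis using True by simp
next
  case False
  then have wc: "weakly_critical K f \<mu>" "weakly_critical K f \<kappa>" and eq: "f \<mu> = f \<kappa>"
    using noncritical_or_level by auto
  let ?W = "weakly_critical_complex K f"
  have W: "lefschetz_complex ?W"
    by (rule lefschetz_weakly_critical_complex[OF lefschetz Morse_Bott])
  have "same_complex (weakly_critical_complex (cancel K \<mu> \<kappa>) f) (cancel ?W \<mu> \<kappa>)"
  proof (rule same_complexI)
    fix \<tau> \<sigma> assume "\<tau> \<in> cells (cancel ?W \<mu> \<kappa>)" "\<sigma> \<in> cells (cancel ?W \<mu> \<kappa>)"
    then have "\<tau> \<in> cells (cancel K \<mu> \<kappa>)" "\<sigma> \<in> cells (cancel K \<mu> \<kappa>)"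
      by (auto simp: weakly_critical_def)
    then have "incidence K \<tau> \<kappa> = 0 \<or> incidence K \<mu> \<sigma> = 0 \<or> f \<kappa> \<le> f \<tau> \<and> f \<sigma> \<le> f \<mu>"
      using altered_incidence[of \<tau> \<sigma>] incident by (auto simp: incidence_cancel)
    then show "incidence (weakly_critical_complex (cancel K \<mu> \<kappa>) f) \<tau> \<sigma> =
        incidence (cancel ?W \<mu> \<kappa>) \<tau> \<sigma>"
      using eq by (auto simp: incidence_weakly_critical_complex incidence_cancel)
  qed (auto simp: weakly_critical_cancel)
  then have "dim (boundaries (weakly_critical_complex (cancel K \<mu> \<kappa>) f) j) =
      dim (boundaries (cancel ?W \<mu> \<kappa>) j)"
    using lefschetz_weakly_critical_complex[OF lefschetz_result Morse_Bott_result]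
    by (intro dim_boundaries_cong finite_kcells)
  then show ?thesis
    using dim_boundaries_cancel[OF W, of \<mu> \<kappa> j] wc eq incident
    by (simp add: incidence_weakly_critical_complex)
qed

text \<open>The rank of \<open>\<partial>\<close> drops by one in the degree of \<open>\<kappa>\<close>.  This is matched by a loss of one
  noncritical pair, or of one rank in the weakly critical complex.\<close>

lemma R_series_cancel: "R_series (cancel K \<mu> \<kappa>) f = R_series K f"
proof (rule fps_ext)
  fix j
  have "cdim K \<mu> = cdim K \<kappa> + 1" by (rule lefschetz_cdim[OF lefschetz \<mu> \<kappa> incident])
  then show "fps_nth (R_series (cancel K \<mu> \<kappa>) f) j = fps_nth (R_series K f) j"
    using noncritical_or_level
    by (auto simp: R_series_nth dim_boundaries_cancel[OF lefschetz \<mu> \<kappa> incident, of j]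
      dsnc_cancel[of "Suc j"] dim_boundaries_weakly_critical_cancel[of j])
qed

end

section \<open>Splitting off blocks and isolated cells\<close>

text \<open>The result of Move (IV).\<close>

definition split_off :: "'a complex_data \<Rightarrow> 'a \<Rightarrow> 'a \<Rightarrow> 'a complex_data" where
  "split_off K \<mu> \<kappa> = cancel K \<mu> \<kappa> \<squnion>\<^sub>c elementary_block (cdim K) \<mu> \<kappa>"

lemma cdim_split_off [simp]: "cdim (split_off K \<mu> \<kappa>) = cdim K"
  by (rule ext) (simp add: split_off_def disj_union_def elementary_block_def)

context
  fixes K :: "'a complex_data" and \<mu> \<kappa> :: 'a
  assumes K: "lefschetz_complex K" and \<mu>: "\<mu> \<in> cells K" and \<kappa>: "\<kappa> \<in> cells K"
    and w: "incidence K \<mu> \<kappa> \<noteq> 0"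
begin

lemma cells_split_off: "cells (split_off K \<mu> \<kappa>) = cells K"
  using \<mu> \<kappa> by (auto simp: split_off_def disj_union_def elementary_block_def)

lemma incidence_split_off:
  "\<tau> \<in> cells K \<Longrightarrow> \<sigma> \<in> cells K \<Longrightarrow> incidence (split_off K \<mu> \<kappa>) \<tau> \<sigma> =
    (if \<tau> = \<mu> \<and> \<sigma> = \<kappa> then 1 else if \<tau> \<in> {\<mu>, \<kappa>} \<or> \<sigma> \<in> {\<mu>, \<kappa>} then 0
     else incidence (cancel K \<mu> \<kappa>) \<tau> \<sigma>)"
  by (auto simp: split_off_def disj_union_def elementary_block_def)

lemma kcells_split_off: "kcells (split_off K \<mu> \<kappa>) k = kcells K k"
  by (simp add: kcells_def cells_split_off)

lemma lefschetz_split_off: "lefschetz_complex (split_off K \<mu> \<kappa>)" (is "lefschetz_complex ?S")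
  unfolding lefschetz_complex_iff
proof (intro conjI ballI allI impI)
  let ?C = "cancel K \<mu> \<kappa>"
  have C: "lefschetz_complex ?C" by (rule lefschetz_cancel[OF K \<mu> \<kappa> w])
  have ne: "\<mu> \<noteq> \<kappa>" using lefschetz_cdim[OF K \<mu> \<kappa> w] by auto
  show "finite (kcells ?S k)" for k by (simp add: kcells_split_off finite_kcells[OF K])
  show "cdim ?S \<tau> = cdim ?S \<sigma> + 1"
    if "\<tau> \<in> cells ?S" "\<sigma> \<in> cells ?S" "incidence ?S \<tau> \<sigma> \<noteq> 0" for \<tau> \<sigma>
    using that lefschetz_cdim[OF C, of \<tau> \<sigma>] lefschetz_cdim[OF K \<mu> \<kappa> w]
    by (auto simp: cells_split_off incidence_split_off split: if_splits)
  fix \<tau> \<nu> k assume c: "\<tau> \<in> cells ?S" "\<nu> \<in> cells ?S"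
  have "(\<Sum>\<sigma>\<in>kcells ?S k. incidence ?S \<tau> \<sigma> * incidence ?S \<sigma> \<nu>) =
      (\<Sum>\<sigma>\<in>kcells ?C k. incidence ?S \<tau> \<sigma> * incidence ?S \<sigma> \<nu>)"
    using c ne \<mu> \<kappa>
    by (intro sum.mono_neutral_right)
      (auto simp: kcells_split_off finite_kcells[OF K] kcells_cancel mem_kcells cells_split_off
        incidence_split_off)
  also have "\<dots> = 0"
  proof (cases "\<tau> \<in> {\<mu>, \<kappa>} \<or> \<nu> \<in> {\<mu>, \<kappa>}")
    case True
    then show ?thesis
      using c by (intro sum.neutral)
        (auto simp: kcells_cancel mem_kcells cells_split_off incidence_split_off)
  next
    case False
    then have "(\<Sum>\<sigma>\<in>kcells ?C k. incidence ?S \<tau> \<sigma> * incidence ?S \<sigma> \<nu>) =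
        (\<Sum>\<sigma>\<in>kcells ?C k. incidence ?C \<tau> \<sigma> * incidence ?C \<sigma> \<nu>)"
      using c by (intro sum.cong)
        (auto simp: kcells_cancel mem_kcells cells_split_off incidence_split_off)
    then show ?thesis
      using lefschetz_square[OF C, of \<tau> \<nu> k] c False by (simp add: cells_split_off)
  qed
  finally show "(\<Sum>\<sigma>\<in>kcells ?S k. incidence ?S \<tau> \<sigma> * incidence ?S \<sigma> \<nu>) = 0" .
qed

text \<open>Cancelling \<open>(\<mu>, \<kappa>)\<close> in the result gives the same complex as cancelling it in \<open>K\<close>.\<close>

lemma dim_boundaries_split_off: "dim (boundaries (split_off K \<mu> \<kappa>) j) = dim (boundaries K j)"
proof -
  let ?S = "split_off K \<mu> \<kappa>"
  have "same_complex (cancel ?S \<mu> \<kappa>) (cancel K \<mu> \<kappa>)"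
    using \<mu> \<kappa>
    by (intro same_complexI) (auto simp: cells_split_off incidence_cancel[of ?S] incidence_split_off)
  moreover have "lefschetz_complex (cancel ?S \<mu> \<kappa>)"
    by (rule lefschetz_cancel[OF lefschetz_split_off])
      (simp_all add: cells_split_off incidence_split_off \<mu> \<kappa>)
  ultimately have "dim (boundaries (cancel ?S \<mu> \<kappa>) j) = dim (boundaries (cancel K \<mu> \<kappa>) j)"
    by (intro dim_boundaries_cong finite_kcells)
  then show ?thesis
    using dim_boundaries_cancel[OF lefschetz_split_off, of \<mu> \<kappa> j]
      dim_boundaries_cancel[OF K \<mu> \<kappa> w, of j]
    by (simp add: cells_split_off incidence_split_off \<mu> \<kappa>)
qed

lemma Morse_Bott_split_off:
  assumes f: "discrete_Morse_Bott K f"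
    and dim: "\<And>\<sigma>. \<sigma> \<in> cells K \<Longrightarrow> cdim K \<sigma> = cdim K \<mu> \<or> cdim K \<sigma> = cdim K \<kappa> \<Longrightarrow> f \<sigma> = real (cdim K \<sigma>)"
  shows "discrete_Morse_Bott (split_off K \<mu> \<kappa>) f"
proof (rule discrete_Morse_Bott_subset[OF K f lefschetz_split_off])
  have d: "cdim K \<mu> = cdim K \<kappa> + 1" by (rule lefschetz_cdim[OF K \<mu> \<kappa> w])
  fix \<tau> \<sigma> assume "\<tau> \<in> cells (split_off K \<mu> \<kappa>)" "\<sigma> \<in> cells (split_off K \<mu> \<kappa>)"
    and inc: "incidence (split_off K \<mu> \<kappa>) \<tau> \<sigma> \<noteq> 0" and less: "f \<tau> < f \<sigma>"
  then have c: "\<tau> \<in> cells K" "\<sigma> \<in> cells K" by (simp_all add: cells_split_off)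
  have "incidence K \<tau> \<sigma> \<noteq> 0"
  proof
    assume "incidence K \<tau> \<sigma> = 0"
    with inc c have "\<tau> = \<mu> \<and> \<sigma> = \<kappa> \<or> incidence K \<tau> \<kappa> \<noteq> 0 \<and> incidence K \<mu> \<sigma> \<noteq> 0"
      by (auto simp: incidence_split_off incidence_cancel split: if_splits)
    then have "cdim K \<tau> = cdim K \<mu>" "cdim K \<sigma> = cdim K \<kappa>"
      using lefschetz_cdim[OF K c(1) \<kappa>] lefschetz_cdim[OF K \<mu> c(2)] d by auto
    then show False using dim[of \<tau>] dim[of \<sigma>] c less d by simp
  qed
  then show "incidence K \<tau> \<sigma> \<noteq> 0 \<and> f \<tau> < f \<sigma>" using less by simp
qed (simp add: cells_split_off)

end

lemma cells_remove_cell [simp]: "cells (remove_cell K \<eta>) = cells K - {\<eta>}"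
  and cdim_remove_cell [simp]: "cdim (remove_cell K \<eta>) = cdim K"
  and incidence_remove_cell [simp]: "incidence (remove_cell K \<eta>) = incidence K"
  by (simp_all add: remove_cell_def)

lemma kcells_remove_cell: "kcells (remove_cell K \<eta>) k = kcells K k - {\<eta>}"
  by (auto simp: kcells_def)

lemma lefschetz_remove_cell:
  assumes K: "lefschetz_complex K" and \<eta>: "isolated_cell K \<eta>"
  shows "lefschetz_complex (remove_cell K \<eta>)"
proof -
  have "(\<Sum>\<sigma>\<in>kcells K k - {\<eta>}. incidence K \<tau> \<sigma> * incidence K \<sigma> \<nu>) = 0"
    if "\<tau> \<in> cells K" "\<nu> \<in> cells K" for \<tau> \<nu> k
  proof -
    have "(\<Sum>\<sigma>\<in>kcells K k - {\<eta>}. incidence K \<tau> \<sigma> * incidence K \<sigma> \<nu>) =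
        (\<Sum>\<sigma>\<in>kcells K k. incidence K \<tau> \<sigma> * incidence K \<sigma> \<nu>)"
      using \<eta> that finite_kcells[OF K]
      by (intro sum.mono_neutral_left) (auto simp: isolated_cell_def)
    then show ?thesis using lefschetz_square[OF K that] by simp
  qed
  then show ?thesis
    using K by (simp add: lefschetz_complex_iff kcells_remove_cell)
qed

lemma Morse_Bott_remove_cell:
  assumes "lefschetz_complex K" "discrete_Morse_Bott K f" "isolated_cell K \<eta>"
  shows "discrete_Morse_Bott (remove_cell K \<eta>) f"
  by (rule discrete_Morse_Bott_subset[OF assms(1,2) lefschetz_remove_cell[OF assms(1,3)]]) auto

lemma dim_boundaries_remove_cell:
  assumes K: "lefschetz_complex K" and \<eta>: "isolated_cell K \<eta>"
  shows "dim (boundaries (remove_cell K \<eta>) j) = dim (boundaries K j)"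
proof -
  let ?w = "incidence K" and ?A = "kcells K (j + 1)" and ?B = "kcells K j"
  have fin: "finite ?A" "finite ?B" by (rule finite_kcells[OF K])+
  have zero: "?w \<sigma> \<eta> = 0" "?w \<eta> \<sigma> = 0" if "\<sigma> \<in> cells K" for \<sigma>
    using \<eta> that by (auto simp: isolated_cell_def)
  have "incidence_rank ?w ?A ?B = incidence_rank ?w (?A - {\<eta>}) ?B"
  proof (cases "\<eta> \<in> ?A")
    case True
    show ?thesis
      by (rule incidence_rank_remove_row[where c = "\<lambda>\<tau>. if \<tau> = \<eta> then 1 else 0"])
        (use True fin zero in \<open>auto simp: mem_kcells if_distrib[where f = "\<lambda>x. x * _"] cong: if_cong\<close>)
  qed simp
  also have "\<dots> = incidence_rank ?w (?A - {\<eta>}) (?B - {\<eta>})"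
  proof (cases "\<eta> \<in> ?B")
    case True
    show ?thesis
      by (rule incidence_rank_remove_column[where c = "\<lambda>_. 0"])
        (use True fin zero in \<open>auto simp: mem_kcells\<close>)
  qed simp
  finally show ?thesis
    using K lefschetz_remove_cell[OF K \<eta>] by (simp add: dim_boundaries finite_kcells kcells_remove_cell)
qed

section \<open>Functions increasing with dimension in low dimensions\<close>

definition increasing_upto :: "'a complex_data \<Rightarrow> ('a \<Rightarrow> real) \<Rightarrow> nat \<Rightarrow> bool" where
  "increasing_upto K f m \<longleftrightarrow> (\<forall>\<tau>\<in>cells K. \<forall>\<sigma>\<in>cells K.
     incidence K \<tau> \<sigma> \<noteq> 0 \<longrightarrow> cdim K \<tau> \<le> m \<longrightarrow> f \<sigma> < f \<tau>)"

lemma increasing_uptoD: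
  "increasing_upto K f m \<Longrightarrow> \<tau> \<in> cells K \<Longrightarrow> \<sigma> \<in> cells K \<Longrightarrow> incidence K \<tau> \<sigma> \<noteq> 0 \<Longrightarrow>
    cdim K \<tau> \<le> m \<Longrightarrow> f \<sigma> < f \<tau>"
  by (simp add: increasing_upto_def)

lemma Dsnc_increasing:
  assumes "lefschetz_complex K" "increasing_upto K f m" "\<sigma> \<in> cells K" "cdim K \<sigma> \<le> m"
  shows "Dsnc K f \<sigma> = 0"
  using assms by (auto simp: Dsnc_eq_0_iff dest: increasing_uptoD intro: less_imp_le)

text \<open>There are then neither noncritical pairs nor level pairs in low degrees, so only the boundary
  ranks of \<open>K\<close> itself survive.\<close>

lemma R_series_nth_increasing:
  assumes K: "lefschetz_complex K" and inc: "increasing_upto K f m" and j: "j < m"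
  shows "fps_nth (R_series K f) j = int (dim (boundaries K j))"
proof -
  have "dsnc K f (j + 1) = 0"
    using j Dsnc_increasing[OF K inc] by (auto simp: dsnc_def mem_kcells intro!: card_eq_0_iff[THEN iffD2])
  moreover have "dim (boundaries (weakly_critical_complex K f) j) = 0"
  proof -
    have "incidence (weakly_critical_complex K f) \<tau> \<sigma> = 0"
      if "\<tau> \<in> kcells K (j + 1)" "\<sigma> \<in> kcells K j" for \<tau> \<sigma>
    proof (cases "incidence K \<tau> \<sigma> = 0")
      case False
      then have "f \<sigma> < f \<tau>"
        using that j increasing_uptoD[OF inc, of \<tau> \<sigma>] by (simp add: mem_kcells)
      then show ?thesis by (simp add: incidence_weakly_critical_complex)
    qed (simp add: incidence_weakly_critical_complex)
    then have "incidence_rank (incidence (weakly_critical_complex K f))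
        (kcells (weakly_critical_complex K f) (j + 1)) (kcells (weakly_critical_complex K f) j) = 0"
      by (intro incidence_rank_zero) (meson kcells_weakly_critical_subset subsetD)
    then show ?thesis
      using finite_subset[OF kcells_weakly_critical_subset finite_kcells[OF K]]
      by (simp add: dim_boundaries)
  qed
  ultimately show ?thesis by (simp add: R_series_nth)
qed

text \<open>If \<open>f\<close> is increasing up to dimension \<open>m\<close>, the part of \<open>R_series\<close> that involves \<open>f\<close> is
  determined by the cells of dimension at least \<open>m\<close>: it vanishes below degree \<open>m\<close>, and whether an
  \<open>m\<close>-cell is weakly critical depends on its cofaces alone.\<close>

lemma R_series_eqI_high:
  assumes K: "lefschetz_complex K" and L: "lefschetz_complex L"
    and incK: "increasing_upto K f m" and incL: "increasing_upto L f m"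
    and rank: "\<And>j. dim (boundaries K j) = dim (boundaries L j)"
    and kcells: "\<And>k. m \<le> k \<Longrightarrow> kcells K k = kcells L k"
    and incidence: "\<And>k \<tau> \<sigma>. m \<le> k \<Longrightarrow> \<tau> \<in> kcells K (k + 1) \<Longrightarrow> \<sigma> \<in> kcells K k \<Longrightarrow>
      incidence K \<tau> \<sigma> = incidence L \<tau> \<sigma>"
  shows "R_series K f = R_series L f"
proof (rule fps_ext)
  fix j
  show "fps_nth (R_series K f) j = fps_nth (R_series L f) j"
  proof (cases "j < m")
    case True
    then show ?thesis
      using R_series_nth_increasing[OF K incK] R_series_nth_increasing[OF L incL] rank by simp
  next
    case False
    have U: "Usnc K f \<sigma> = Usnc L f \<sigma>" if "\<sigma> \<in> kcells K k" "m \<le> k" for \<sigma> k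
    proof -
      have "{\<tau> \<in> cells K. incidence K \<tau> \<sigma> \<noteq> 0 \<and> f \<tau> < f \<sigma>} =
          {\<tau> \<in> kcells K (k + 1). incidence K \<tau> \<sigma> \<noteq> 0 \<and> f \<tau> < f \<sigma>}"
        by (rule cofaces_eq[OF K that(1)])
      also have "\<dots> = {\<tau> \<in> kcells L (k + 1). incidence L \<tau> \<sigma> \<noteq> 0 \<and> f \<tau> < f \<sigma>}"
        using kcells[of "k + 1"] incidence[OF that(2)] that by auto
      also have "\<dots> = {\<tau> \<in> cells L. incidence L \<tau> \<sigma> \<noteq> 0 \<and> f \<tau> < f \<sigma>}"
        using cofaces_eq[OF L, of \<sigma> k] that kcells[OF that(2)] by simp
      finally show ?thesis by (simp add: Usnc_def)
    qed
    have D': "Dsnc K f \<sigma> = Dsnc L f \<sigma>" if "\<sigma> \<in> kcells K (k + 1)" "m \<le> k" for \<sigma> k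
    proof -
      have "{\<nu> \<in> cells K. incidence K \<sigma> \<nu> \<noteq> 0 \<and> f \<sigma> < f \<nu>} =
          {\<nu> \<in> kcells K k. incidence K \<sigma> \<nu> \<noteq> 0 \<and> f \<sigma> < f \<nu>}"
        by (rule faces_eq[OF K that(1)])
      also have "\<dots> = {\<nu> \<in> kcells L k. incidence L \<sigma> \<nu> \<noteq> 0 \<and> f \<sigma> < f \<nu>}"
        using kcells[OF that(2)] incidence[OF that(2,1)] by auto
      also have "\<dots> = {\<nu> \<in> cells L. incidence L \<sigma> \<nu> \<noteq> 0 \<and> f \<sigma> < f \<nu>}"
        using faces_eq[OF L, of \<sigma> k] that kcells[of "k + 1"] by simp
      finally show ?thesis by (simp add: Dsnc_def)
    qed
    have D: "Dsnc K f \<sigma> = Dsnc L f \<sigma>" if \<sigma>: "\<sigma> \<in> kcells K k" and k: "m \<le> k" for \<sigma> k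
    proof (cases "k = m")
      case True
      then have "\<sigma> \<in> kcells L m" using \<sigma> kcells by blast
      then show ?thesis
        using \<sigma> True Dsnc_increasing[OF K incK] Dsnc_increasing[OF L incL] by (simp add: mem_kcells)
    next
      case False
      then obtain k' where "k = k' + 1" "m \<le> k'" using k by (cases k) auto
      then show ?thesis using D'[of \<sigma> k'] \<sigma> by simp
    qed
    have "dsnc K f (j + 1) = dsnc L f (j + 1)"
      unfolding dsnc_def using D[of _ "j + 1"] kcells[of "j + 1"] False
      by (intro arg_cong[where f = card]) auto
    moreover have W: "kcells (weakly_critical_complex K f) k = kcells (weakly_critical_complex L f) k"
      if "m \<le> k" for k
      using U[OF _ that] D[OF _ that] kcells[OF that] by (auto simp: kcells_weakly_critical_complex)
    have "dim (boundaries (weakly_critical_complex K f) j) =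
        dim (boundaries (weakly_critical_complex L f) j)"
    proof -
      have "incidence_rank (incidence (weakly_critical_complex K f))
          (kcells (weakly_critical_complex K f) (j + 1)) (kcells (weakly_critical_complex K f) j) =
        incidence_rank (incidence (weakly_critical_complex L f))
          (kcells (weakly_critical_complex K f) (j + 1)) (kcells (weakly_critical_complex K f) j)"
      proof (rule incidence_rank_cong)
        fix \<tau> \<sigma> assume "\<tau> \<in> kcells (weakly_critical_complex K f) (j + 1)"
          and "\<sigma> \<in> kcells (weakly_critical_complex K f) j"
        then have "\<tau> \<in> kcells K (j + 1)" "\<sigma> \<in> kcells K j"
          using kcells_weakly_critical_subset[of K f] by blast+
        then show "incidence (weakly_critical_complex K f) \<tau> \<sigma> =
            incidence (weakly_critical_complex L f) \<tau> \<sigma>"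
          using incidence[of j \<tau> \<sigma>] False by (simp add: incidence_weakly_critical_complex)
      qed
      moreover have "finite (kcells (weakly_critical_complex M f) (j + 1))"
        if "lefschetz_complex M" for M :: "'a complex_data"
        using finite_subset[OF kcells_weakly_critical_subset finite_kcells[OF that]] .
      ultimately show ?thesis
        using False W K L by (simp add: dim_boundaries)
    qed
    ultimately show ?thesis using rank by (simp add: R_series_nth)
  qed
qed

text \<open>Suppose no pair in degree \<open>k\<close> is noncritical, but \<open>f\<close> takes the same value on incident
  \<open>\<tau>\<close> and \<open>\<sigma>\<close> of dimensions \<open>k + 1\<close> and \<open>k\<close>.  Both cells are then weakly critical, so
  they form a cancellable pair.  For \<open>\<tau>\<close> this needs a second path: a coface \<open>\<rho>\<close> with smaller
  value would reach \<open>\<sigma>\<close> through another cell \<open>\<tau>'\<close>, whose value would be at least that of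
  \<open>\<sigma>\<close> and at most that of \<open>\<rho>\<close>.\<close>

lemma increasing_upto_Suc_or_cancellable:
  assumes K: "lefschetz_complex K" and f: "discrete_Morse_Bott K f" and inc: "increasing_upto K f k"
    and none: "\<And>\<mu> \<kappa>. cancellable_pair K f \<mu> \<kappa> \<Longrightarrow> cdim K \<kappa> \<noteq> k"
  shows "increasing_upto K f (k + 1)"
  unfolding increasing_upto_def
proof (intro ballI impI)
  fix \<tau> \<sigma> assume c: "\<tau> \<in> cells K" "\<sigma> \<in> cells K" and w: "incidence K \<tau> \<sigma> \<noteq> 0"
    and d: "cdim K \<tau> \<le> k + 1"
  show "f \<sigma> < f \<tau>"
  proof (cases "cdim K \<tau> \<le> k")
    case True
    then show ?thesis using increasing_uptoD[OF inc c w] by simp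
  next
    case False
    have le: "f \<beta> \<le> f \<alpha>"
      if "\<alpha> \<in> cells K" "\<beta> \<in> cells K" "incidence K \<alpha> \<beta> \<noteq> 0" "cdim K \<beta> = k" for \<alpha> \<beta>
    proof (rule ccontr)
      assume "\<not> f \<beta> \<le> f \<alpha>"
      then have "cancellable_pair K f \<alpha> \<beta>" using K f that by unfold_locales auto
      then show False using none that by blast
    qed
    have d\<tau>: "cdim K \<tau> = k + 1" using False d by simp
    then have d\<sigma>: "cdim K \<sigma> = k" using lefschetz_cdim[OF K c w] by simp
    show ?thesis
    proof (rule ccontr)
      assume "\<not> f \<sigma> < f \<tau>"
      then have eq: "f \<tau> = f \<sigma>" using le[OF c w d\<sigma>] by simp
      have "f \<nu> \<le> f \<sigma>" if "\<nu> \<in> cells K" "incidence K \<sigma> \<nu> \<noteq> 0" for \<nu>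
        using increasing_uptoD[OF inc c(2) that] d\<sigma> by simp
      then have \<sigma>: "weakly_critical K f \<sigma>"
        unfolding weakly_critical_iff[OF K] using c le d\<sigma> by blast
      have "f \<nu> \<le> f \<tau>" if "\<nu> \<in> cells K" "incidence K \<tau> \<nu> \<noteq> 0" for \<nu>
        using le[OF c(1) that] lefschetz_cdim[OF K c(1) that] d\<tau> by simp
      moreover have "f \<tau> \<le> f \<rho>" if \<rho>: "\<rho> \<in> cells K" "incidence K \<rho> \<tau> \<noteq> 0" for \<rho>
      proof (rule ccontr)
        assume n: "\<not> f \<tau> \<le> f \<rho>"
        obtain \<tau>' where \<tau>': "\<tau>' \<in> cells K" "\<tau>' \<noteq> \<tau>" "incidence K \<rho> \<tau>' \<noteq> 0" "incidence K \<tau>' \<sigma> \<noteq> 0"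
          using lefschetz_second_path[OF K \<rho>(1) c \<rho>(2) w] .
        have "f \<tau>' \<le> f \<rho>" using Morse_Bott_face_unique[OF K f \<rho>(1) c(1) \<rho>(2)] n \<tau>' by simp
        moreover have "f \<sigma> \<le> f \<tau>'" using le[OF \<tau>'(1) c(2) \<tau>'(4) d\<sigma>] .
        ultimately show False using n eq by simp
      qed
      ultimately have "weakly_critical K f \<tau>"
        unfolding weakly_critical_iff[OF K] using c by blast
      then have "cancellable_pair K f \<tau> \<sigma>" using K f c w \<sigma> eq by unfold_locales auto
      then show False using none d\<sigma> by blast
    qed
  qed
qed

lemma increasing_upto_cancel:
  assumes K: "lefschetz_complex K" and inc: "increasing_upto K f k" and \<kappa>: "\<kappa> \<in> cells K" "cdim K \<kappa> = k"
  shows "increasing_upto (cancel K \<mu> \<kappa>) f k"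
  unfolding increasing_upto_def
proof (intro ballI impI)
  fix \<tau> \<sigma> assume c: "\<tau> \<in> cells (cancel K \<mu> \<kappa>)" "\<sigma> \<in> cells (cancel K \<mu> \<kappa>)"
    and w: "incidence (cancel K \<mu> \<kappa>) \<tau> \<sigma> \<noteq> 0" and d: "cdim (cancel K \<mu> \<kappa>) \<tau> \<le> k"
  have "incidence K \<tau> \<kappa> = 0" using lefschetz_cdim[OF K _ \<kappa>(1), of \<tau>] c d \<kappa>(2) by fastforce
  then have "incidence K \<tau> \<sigma> \<noteq> 0" using w by (simp add: incidence_cancel)
  then show "f \<sigma> < f \<tau>" using increasing_uptoD[OF inc, of \<tau> \<sigma>] c d by simp
qed

section \<open>Partly split complexes\<close>

definition matching :: "('a \<times> 'a) set \<Rightarrow> bool" where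
  "matching P \<longleftrightarrow> (\<forall>p\<in>P. \<forall>q\<in>P. p \<noteq> q \<longrightarrow> {fst p, snd p} \<inter> {fst q, snd q} = {})"

definition pair_cells :: "('a \<times> 'a) set \<Rightarrow> 'a set" where
  "pair_cells P = fst ` P \<union> snd ` P"

lemma pair_cellsI: "(\<mu>, \<kappa>) \<in> P \<Longrightarrow> \<mu> \<in> pair_cells P" "(\<mu>, \<kappa>) \<in> P \<Longrightarrow> \<kappa> \<in> pair_cells P"
  by (force simp: pair_cells_def)+

lemma pair_cells_insert: "pair_cells (insert (\<mu>, \<kappa>) P) = {\<mu>, \<kappa>} \<union> pair_cells P"
  by (auto simp: pair_cells_def)

lemma pair_cells_mono: "P \<subseteq> Q \<Longrightarrow> pair_cells P \<subseteq> pair_cells Q"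
  by (auto simp: pair_cells_def)

lemma pair_cellsE:
  assumes "\<sigma> \<in> pair_cells P" obtains \<mu> \<kappa> where "(\<mu>, \<kappa>) \<in> P" "\<sigma> = \<mu> \<or> \<sigma> = \<kappa>"
  using assms by (force simp: pair_cells_def)

text \<open>The invariant of the construction: \<open>L\<close> is the disjoint union of the blocks on the pairs
  \<open>P\<close>, where \<open>f\<close> is the dimension, and a complex with cells of dimension at least \<open>n\<close>.\<close>

locale partly_split =
  fixes d :: "'a \<Rightarrow> nat" and n :: nat and P :: "('a \<times> 'a) set"
    and L :: "'a complex_data" and f :: "'a \<Rightarrow> real"
  assumes cdim: "cdim L = d" and lefschetz: "lefschetz_complex L"
    and Morse_Bott: "discrete_Morse_Bott L f"
    and finite: "finite P" and matching: "matching P"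
    and cdim_pair: "\<And>\<mu> \<kappa>. (\<mu>, \<kappa>) \<in> P \<Longrightarrow> d \<mu> = d \<kappa> + 1"
    and pair_cells: "pair_cells P \<subseteq> cells L"
    and incidence_pair: "\<And>\<tau> \<sigma>. \<tau> \<in> cells L \<Longrightarrow> \<sigma> \<in> cells L \<Longrightarrow>
      \<tau> \<in> pair_cells P \<or> \<sigma> \<in> pair_cells P \<Longrightarrow> incidence L \<tau> \<sigma> = (if (\<tau>, \<sigma>) \<in> P then 1 else 0)"
    and dim_on_pairs: "\<And>\<sigma>. \<sigma> \<in> pair_cells P \<Longrightarrow> f \<sigma> = real (d \<sigma>)"
    and cdim_rest: "\<And>\<sigma>. \<sigma> \<in> cells L \<Longrightarrow> \<sigma> \<notin> pair_cells P \<Longrightarrow> n \<le> d \<sigma>"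
begin

lemma incident_in_pairs:
  assumes "\<tau> \<in> cells L" "\<sigma> \<in> cells L" "incidence L \<tau> \<sigma> \<noteq> 0"
    "\<tau> \<in> pair_cells P \<or> \<sigma> \<in> pair_cells P"
  shows "(\<tau>, \<sigma>) \<in> P" and "f \<sigma> < f \<tau>"
proof -
  show P: "(\<tau>, \<sigma>) \<in> P" using incidence_pair assms by (metis (full_types))
  show "f \<sigma> < f \<tau>" using dim_on_pairs[of \<tau>] dim_on_pairs[of \<sigma>] pair_cellsI[OF P] cdim_pair[OF P] by simp
qed

lemma increasing: "increasing_upto L f n"
  unfolding increasing_upto_def
proof (intro ballI impI)
  fix \<tau> \<sigma> assume c: "\<tau> \<in> cells L" "\<sigma> \<in> cells L" and w: "incidence L \<tau> \<sigma> \<noteq> 0" and "cdim L \<tau> \<le> n"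
  then have "d \<sigma> < n" using lefschetz_cdim[OF lefschetz c w] cdim by simp
  then have "\<sigma> \<in> pair_cells P" using cdim_rest[OF c(2)] by force
  then show "f \<sigma> < f \<tau>" using incident_in_pairs c w by blast
qed

lemma Morse_Bott_pair: "Morse_Bott_pair (L, f)"
  using lefschetz Morse_Bott by (simp add: Morse_Bott_pair_def)

lemma cancellable_notin_pairs:
  assumes "cancellable_pair L f \<mu> \<kappa>" shows "\<mu> \<notin> pair_cells P" "\<kappa> \<notin> pair_cells P"
proof -
  interpret cancellable_pair L f \<mu> \<kappa> by fact
  show "\<mu> \<notin> pair_cells P" "\<kappa> \<notin> pair_cells P"
    using incident_in_pairs(2)[OF \<mu> \<kappa> incident] le by auto
qed

lemma partly_split_cancel:
  assumes "cancellable_pair L f \<mu> \<kappa>"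
  shows "partly_split d n P (cancel L \<mu> \<kappa>) f"
proof -
  interpret c: cancellable_pair L f \<mu> \<kappa> by fact
  note notin = cancellable_notin_pairs[OF assms]
  show ?thesis
  proof unfold_locales
    fix \<tau> \<sigma> assume c: "\<tau> \<in> cells (cancel L \<mu> \<kappa>)" "\<sigma> \<in> cells (cancel L \<mu> \<kappa>)"
      and P: "\<tau> \<in> pair_cells P \<or> \<sigma> \<in> pair_cells P"
    have "incidence L \<tau> \<kappa> = 0" if "\<tau> \<in> pair_cells P"
      using incident_in_pairs(1)[of \<tau> \<kappa>] that notin c c.\<kappa> pair_cellsI(2)[of \<tau> \<kappa> P] by auto
    moreover have "incidence L \<mu> \<sigma> = 0" if "\<sigma> \<in> pair_cells P"
      using incident_in_pairs(1)[of \<mu> \<sigma>] that notin c c.\<mu> pair_cellsI(1)[of \<mu> \<sigma> P] by auto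
    ultimately have "incidence (cancel L \<mu> \<kappa>) \<tau> \<sigma> = incidence L \<tau> \<sigma>"
      using P by (auto simp: incidence_cancel)
    then show "incidence (cancel L \<mu> \<kappa>) \<tau> \<sigma> = (if (\<tau>, \<sigma>) \<in> P then 1 else 0)"
      using incidence_pair[of \<tau> \<sigma>] c P by simp
  qed (use cdim c.lefschetz_result c.Morse_Bott_result finite matching cdim_pair pair_cells
      dim_on_pairs cdim_rest notin in auto)
qed

lemma move_cancel:
  assumes "cancellable_pair L f \<mu> \<kappa>" shows "move (L, f) (cancel L \<mu> \<kappa>, f)"
proof -
  interpret c: cancellable_pair L f \<mu> \<kappa> by fact
  show ?thesis
    using Morse_Bott_pair c.noncritical_or_level c.\<mu> c.\<kappa> c.incident
    by (auto simp: move_def intro: move_Ia move_Ib)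
qed

end

section \<open>One stage of the construction\<close>

text \<open>Moves (I) on pairs of dimensions \<open>k + 1\<close> and \<open>k\<close> until none is available; each uses up a
  \<open>k\<close>-cell.\<close>

lemma cancel_all_in_degree:
  assumes "partly_split d n P L f" "increasing_upto L f k"
  shows "\<exists>L'. move\<^sup>*\<^sup>* (L, f) (L', f) \<and> partly_split d n P L' f \<and> increasing_upto L' f (k + 1) \<and>
    R_series L' f = R_series L f"
  using assms
proof (induction "card (kcells L k)" arbitrary: L rule: less_induct)
  case less
  interpret partly_split d n P L f by fact
  show ?case
  proof (cases "\<exists>\<mu> \<kappa>. cancellable_pair L f \<mu> \<kappa> \<and> cdim L \<kappa> = k")
    case False
    have "increasing_upto L f (k + 1)"
    proof (rule increasing_upto_Suc_or_cancellable[OF lefschetz Morse_Bott less.prems(2)])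
      show "cdim L \<kappa> \<noteq> k" if "cancellable_pair L f \<mu> \<kappa>" for \<mu> \<kappa>
        using False that by metis
    qed
    then show ?thesis using less.prems(1) by (intro exI[of _ L]) simp
  next
    case True
    then obtain \<mu> \<kappa> where c: "cancellable_pair L f \<mu> \<kappa>" and \<kappa>: "cdim L \<kappa> = k" by blast
    interpret c: cancellable_pair L f \<mu> \<kappa> by (rule c)
    let ?C = "cancel L \<mu> \<kappa>"
    have "kcells ?C k \<subset> kcells L k"
    proof
      show "kcells ?C k \<subseteq> kcells L k" by (simp add: kcells_cancel)
      have "\<kappa> \<in> kcells L k" "\<kappa> \<notin> kcells ?C k"
        using c.\<kappa> \<kappa> by (simp_all add: kcells_cancel kcells_def)
      then show "kcells ?C k \<noteq> kcells L k" by blast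
    qed
    then have "card (kcells ?C k) < card (kcells L k)"
      by (rule psubset_card_mono[OF finite_kcells[OF lefschetz]])
    from less.hyps[OF this partly_split_cancel[OF c]
        increasing_upto_cancel[OF lefschetz less.prems(2) c.\<kappa> \<kappa>]]
    obtain L' where *: "move\<^sup>*\<^sup>* (?C, f) (L', f)" "partly_split d n P L' f"
      "increasing_upto L' f (k + 1)" "R_series L' f = R_series ?C f"
      by (elim exE conjE)
    have "move\<^sup>*\<^sup>* (L, f) (L', f)"
      using move_cancel[OF c] *(1) by (rule converse_rtranclp_into_rtranclp)
    then show ?thesis
      using * c.R_series_cancel by (intro exI[of _ L']) simp
  qed
qed

text \<open>When \<open>f\<close> increases strictly up to dimension \<open>n + 2\<close>, Move (III) may replace it by the
  dimension on all cells of dimension at most \<open>n + 1\<close>.  On the cells of larger dimension outside the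
  blocks \<open>f\<close> is shifted by a constant, chosen so that the finitely many cells of dimension \<open>n + 2\<close>
  stay above the value \<open>n + 1\<close> of their faces.\<close>

lemma normalize_function:
  assumes "partly_split d n P L f" and inc: "increasing_upto L f (n + 2)"
  shows "\<exists>g. move (L, f) (L, g) \<and> partly_split d n P L g \<and> increasing_upto L g (n + 2) \<and>
    (\<forall>\<sigma>\<in>cells L. d \<sigma> \<le> n + 1 \<longrightarrow> g \<sigma> = real (d \<sigma>)) \<and> R_series L g = R_series L f"
proof -
  interpret partly_split d n P L f by fact
  \<comment> \<open>A lower bound for \<open>f\<close> in dimension \<open>n + 2\<close>; inserting 0 covers the case of no such cell.\<close>
  define b where "b = Min (insert 0 (f ` kcells L (n + 2)))"
  have b: "b \<le> f \<sigma>" if "\<sigma> \<in> kcells L (n + 2)" for \<sigma>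
    unfolding b_def using that finite_kcells[OF lefschetz] by (intro Min_le) auto
  define g where "g \<sigma> = (if \<sigma> \<in> pair_cells P \<or> d \<sigma> \<le> n + 1 then real (d \<sigma>)
    else f \<sigma> + (real n + 2 - b))" for \<sigma>
  have order: "(f \<tau> < f \<sigma> \<longleftrightarrow> g \<tau> < g \<sigma>) \<and> (f \<sigma> < f \<tau> \<longleftrightarrow> g \<sigma> < g \<tau>)"
    if c: "\<tau> \<in> cells L" "\<sigma> \<in> cells L" and w: "incidence L \<tau> \<sigma> \<noteq> 0" for \<tau> \<sigma>
  proof -
    have dims: "d \<tau> = d \<sigma> + 1" using lefschetz_cdim[OF lefschetz c w] cdim by simp
    consider "\<tau> \<in> pair_cells P \<or> \<sigma> \<in> pair_cells P"
      | "\<tau> \<notin> pair_cells P" "\<sigma> \<notin> pair_cells P" "d \<tau> \<le> n + 1"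
      | "\<tau> \<notin> pair_cells P" "\<sigma> \<notin> pair_cells P" "d \<tau> = n + 2"
      | "\<tau> \<notin> pair_cells P" "\<sigma> \<notin> pair_cells P" "d \<tau> > n + 2" by linarith
    then show ?thesis
    proof cases
      case 1
      then have "(\<tau>, \<sigma>) \<in> P" "f \<sigma> < f \<tau>" using incident_in_pairs[OF c w] by blast+
      then show ?thesis using dims by (auto simp: g_def dest: pair_cellsI)
    next
      case 2
      then have "f \<sigma> < f \<tau>" using increasing_uptoD[OF inc c w] cdim by simp
      then show ?thesis using 2 dims by (auto simp: g_def)
    next
      case 3
      then have "f \<sigma> < f \<tau>" "b \<le> f \<tau>"
        using increasing_uptoD[OF inc c w] b[of \<tau>] c cdim by (auto simp: mem_kcells)
      then show ?thesis using 3 dims by (auto simp: g_def)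
    next
      case 4
      then show ?thesis using dims by (auto simp: g_def)
    qed
  qed
  then have iff: "f \<alpha> < f \<beta> \<longleftrightarrow> g \<alpha> < g \<beta>" if "\<alpha> \<in> cells L" "\<beta> \<in> cells L"
    "incidence L \<alpha> \<beta> \<noteq> 0 \<or> incidence L \<beta> \<alpha> \<noteq> 0" for \<alpha> \<beta>
    using that by blast
  have refl: "same_complex L L" by (simp add: same_complex_def subcomplex_def)
  have "discrete_Morse_Bott L f \<longleftrightarrow> discrete_Morse_Bott L g"
    by (rule discrete_Morse_Bott_cong[OF refl]) (rule iff)
  with Morse_Bott have "discrete_Morse_Bott L g" by simp
  then have "partly_split d n P L g"
    using cdim lefschetz finite matching cdim_pair pair_cells incidence_pair cdim_rest
    by unfold_locales (auto simp: g_def)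
  moreover have "move (L, f) (L, g)"
    using Morse_Bott_pair iff by (auto simp: move_def intro!: move_III)
  moreover have "increasing_upto L g (n + 2)"
    using inc order unfolding increasing_upto_def by blast
  moreover have "\<forall>\<sigma>\<in>cells L. d \<sigma> \<le> n + 1 \<longrightarrow> g \<sigma> = real (d \<sigma>)"
    by (simp add: g_def)
  moreover have "R_series L f = R_series L g"
    by (rule R_series_cong[OF refl _ lefschetz]) (rule iff)
  ultimately show ?thesis by (intro exI[of _ g]) simp
qed

text \<open>The next two lemmas treat an \<open>n\<close>-cell \<open>\<kappa>\<close> outside the blocks after normalisation: if it
  has a coface, Move (IV) puts the pair into a block; otherwise it is isolated and Move (II) deletes it.
  Both moves alter only cells of dimension \<open>n\<close> and \<open>n + 1\<close>, which lie in the range where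
  \<open>f\<close> is increasing, so the remainder series does not change.\<close>

context partly_split
begin

lemma split_off_step:
  assumes inc: "increasing_upto L f (n + 2)"
    and low: "\<forall>\<sigma>\<in>cells L. d \<sigma> \<le> n + 1 \<longrightarrow> f \<sigma> = real (d \<sigma>)"
    and \<mu>: "\<mu> \<in> cells L" and \<kappa>: "\<kappa> \<in> cells L" and w: "incidence L \<mu> \<kappa> \<noteq> 0"
    and d\<kappa>: "d \<kappa> = n" and notin: "\<kappa> \<notin> pair_cells P"
  shows "move (L, f) (split_off L \<mu> \<kappa>, f)"
    and "partly_split d n (insert (\<mu>, \<kappa>) P) (split_off L \<mu> \<kappa>) f"
    and "increasing_upto (split_off L \<mu> \<kappa>) f (n + 2)"
    and "R_series (split_off L \<mu> \<kappa>) f = R_series L f"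
proof -
  let ?S = "split_off L \<mu> \<kappa>"
  note dim = low[rule_format]
  note cells_S = cells_split_off[OF lefschetz \<mu> \<kappa> w]
  note inc_S = incidence_split_off[OF lefschetz \<mu> \<kappa> w]
  note lefschetz_S = lefschetz_split_off[OF lefschetz \<mu> \<kappa> w]
  have d\<mu>: "d \<mu> = n + 1" using lefschetz_cdim[OF lefschetz \<mu> \<kappa> w] d\<kappa> cdim by simp
  have notin\<mu>: "\<mu> \<notin> pair_cells P"
    using incident_in_pairs(1)[OF \<mu> \<kappa> w] notin pair_cellsI(2) by metis
  have dim': "f \<sigma> = real (cdim L \<sigma>)" if "\<sigma> \<in> cells L" "cdim L \<sigma> = cdim L \<mu> \<or> cdim L \<sigma> = cdim L \<kappa>" for \<sigma>
    using that dim[of \<sigma>] d\<mu> d\<kappa> cdim by auto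
  show "move (L, f) (?S, f)"
    unfolding move_def split_off_def
    using Morse_Bott_pair \<mu> \<kappa> w dim' by (auto intro!: move_IV)
  have altered: "d \<tau> = n + 1 \<and> d \<sigma> = n"
    if c: "\<tau> \<in> cells L" "\<sigma> \<in> cells L" and "incidence (cancel L \<mu> \<kappa>) \<tau> \<sigma> \<noteq> incidence L \<tau> \<sigma>" for \<tau> \<sigma>
  proof -
    have "incidence L \<tau> \<kappa> \<noteq> 0" "incidence L \<mu> \<sigma> \<noteq> 0" using that(3) by (auto simp: incidence_cancel)
    then show ?thesis
      using lefschetz_cdim[OF lefschetz c(1) \<kappa>] lefschetz_cdim[OF lefschetz \<mu> c(2)] d\<kappa> d\<mu> cdim by simp
  qed
  show inc': "increasing_upto ?S f (n + 2)"
    unfolding increasing_upto_def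
  proof (intro ballI impI)
    fix \<tau> \<sigma> assume "\<tau> \<in> cells ?S" "\<sigma> \<in> cells ?S"
      and v: "incidence ?S \<tau> \<sigma> \<noteq> 0" and dt: "cdim ?S \<tau> \<le> n + 2"
    then have c: "\<tau> \<in> cells L" "\<sigma> \<in> cells L" by (simp_all add: cells_S)
    show "f \<sigma> < f \<tau>"
    proof (cases "\<tau> = \<mu> \<and> \<sigma> = \<kappa> \<or> incidence (cancel L \<mu> \<kappa>) \<tau> \<sigma> \<noteq> incidence L \<tau> \<sigma>")
      case True
      then have "d \<tau> = n + 1" "d \<sigma> = n" using altered[OF c] d\<mu> d\<kappa> by auto
      then show ?thesis using dim c by simp
    next
      case False
      then have "incidence L \<tau> \<sigma> \<noteq> 0" using v by (auto simp: inc_S[OF c] split: if_splits)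
      then show ?thesis using increasing_uptoD[OF inc c] dt by simp
    qed
  qed
  show "R_series ?S f = R_series L f"
  proof (rule R_series_eqI_high[OF lefschetz_S lefschetz inc' inc dim_boundaries_split_off[OF lefschetz \<mu> \<kappa> w]
        kcells_split_off[OF lefschetz \<mu> \<kappa> w]])
    fix k \<tau> \<sigma> assume "n + 2 \<le> k" "\<tau> \<in> kcells ?S (k + 1)" "\<sigma> \<in> kcells ?S k"
    then have c: "\<tau> \<in> cells L" "\<sigma> \<in> cells L" and dims: "n + 2 \<le> d \<tau>" "n + 2 \<le> d \<sigma>"
      using cdim by (auto simp: mem_kcells cells_S)
    then show "incidence ?S \<tau> \<sigma> = incidence L \<tau> \<sigma>"
      using inc_S[OF c] altered[OF c] d\<mu> d\<kappa> by auto
  qed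
  show "partly_split d n (insert (\<mu>, \<kappa>) P) ?S f"
  proof unfold_locales
    show "matching (insert (\<mu>, \<kappa>) P)"
      using matching notin notin\<mu> unfolding matching_def pair_cells_def by auto
    fix \<tau> \<sigma> assume "\<tau> \<in> cells ?S" "\<sigma> \<in> cells ?S"
      and P: "\<tau> \<in> pair_cells (insert (\<mu>, \<kappa>) P) \<or> \<sigma> \<in> pair_cells (insert (\<mu>, \<kappa>) P)"
    then have c: "\<tau> \<in> cells L" "\<sigma> \<in> cells L" by (simp_all add: cells_S)
    show "incidence ?S \<tau> \<sigma> = (if (\<tau>, \<sigma>) \<in> insert (\<mu>, \<kappa>) P then 1 else 0)"
    proof (cases "\<tau> \<in> {\<mu>, \<kappa>} \<or> \<sigma> \<in> {\<mu>, \<kappa>}")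
      case True
      then have "(\<tau>, \<sigma>) \<notin> P" using notin notin\<mu> pair_cellsI[of \<tau> \<sigma> P] by auto
      then show ?thesis using True by (auto simp: inc_S[OF c])
    next
      case False
      then have PP: "\<tau> \<in> pair_cells P \<or> \<sigma> \<in> pair_cells P" using P by (auto simp: pair_cells_insert)
      have "incidence L \<tau> \<kappa> = 0" if "\<tau> \<in> pair_cells P"
        using incident_in_pairs(1)[OF c(1) \<kappa>] that notin pair_cellsI(2)[of \<tau> \<kappa> P] by auto
      moreover have "incidence L \<mu> \<sigma> = 0" if "\<sigma> \<in> pair_cells P"
        using incident_in_pairs(1)[OF \<mu> c(2)] that notin\<mu> pair_cellsI(1)[of \<mu> \<sigma> P] by auto
      ultimately show ?thesis
        using False PP incidence_pair[OF c PP] by (auto simp: inc_S[OF c] incidence_cancel)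
    qed
  next
    show "discrete_Morse_Bott ?S f"
      by (rule Morse_Bott_split_off[OF lefschetz \<mu> \<kappa> w Morse_Bott dim'])
    show "\<And>\<sigma>. \<sigma> \<in> pair_cells (insert (\<mu>, \<kappa>) P) \<Longrightarrow> f \<sigma> = real (d \<sigma>)"
      using dim_on_pairs dim \<mu> \<kappa> d\<mu> d\<kappa> by (auto simp: pair_cells_insert)
    show "\<And>\<mu>' \<kappa>'. (\<mu>', \<kappa>') \<in> insert (\<mu>, \<kappa>) P \<Longrightarrow> d \<mu>' = d \<kappa>' + 1"
      using cdim_pair d\<mu> d\<kappa> by auto
  qed (use cdim lefschetz_S finite pair_cells cdim_rest \<mu> \<kappa> in
      \<open>auto simp: pair_cells_insert cells_S\<close>)
qed

lemma remove_step:
  assumes inc: "increasing_upto L f (n + 2)"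
    and \<eta>: "isolated_cell L \<eta>" and d\<eta>: "d \<eta> = n" and notin: "\<eta> \<notin> pair_cells P"
  shows "move (L, f) (remove_cell L \<eta>, f)"
    and "partly_split d n P (remove_cell L \<eta>) f"
    and "increasing_upto (remove_cell L \<eta>) f (n + 2)"
    and "R_series (remove_cell L \<eta>) f = R_series L f"
proof -
  show "move (L, f) (remove_cell L \<eta>, f)"
    using Morse_Bott_pair \<eta> by (auto simp: move_def intro: move_II)
  note lefschetz' = lefschetz_remove_cell[OF lefschetz \<eta>]
  show "partly_split d n P (remove_cell L \<eta>) f"
    using cdim lefschetz' Morse_Bott_remove_cell[OF lefschetz Morse_Bott \<eta>] finite matching cdim_pair
      pair_cells notin incidence_pair dim_on_pairs cdim_rest
    by unfold_locales auto
  show inc': "increasing_upto (remove_cell L \<eta>) f (n + 2)"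
    using inc by (simp add: increasing_upto_def)
  show "R_series (remove_cell L \<eta>) f = R_series L f"
    by (rule R_series_eqI_high[OF lefschetz' lefschetz inc' inc dim_boundaries_remove_cell[OF lefschetz \<eta>]])
      (use d\<eta> cdim in \<open>auto simp: kcells_remove_cell mem_kcells\<close>)
qed

end

text \<open>Each of these moves uses up one \<open>n\<close>-cell outside the blocks.\<close>

lemma split_off_degree:
  assumes "partly_split d n P L f" "increasing_upto L f (n + 2)"
    and "\<forall>\<sigma>\<in>cells L. d \<sigma> \<le> n + 1 \<longrightarrow> f \<sigma> = real (d \<sigma>)"
  shows "\<exists>P' L'. move\<^sup>*\<^sup>* (L, f) (L', f) \<and> partly_split d (n + 1) P' L' f \<and> P \<subseteq> P' \<and>
    (\<forall>(\<mu>, \<kappa>)\<in>P' - P. d \<kappa> = n) \<and> R_series L' f = R_series L f"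
  using assms
proof (induction "card (kcells L n - pair_cells P)" arbitrary: L P rule: less_induct)
  case less
  interpret partly_split d n P L f by fact
  have fin: "Finite_Set.finite (kcells L n - pair_cells P)"
    using finite_kcells[OF lefschetz] by blast
  show ?case
  proof (cases "kcells L n \<subseteq> pair_cells P")
    case True
    have "n + 1 \<le> d \<sigma>" if "\<sigma> \<in> cells L" "\<sigma> \<notin> pair_cells P" for \<sigma>
      using cdim_rest[OF that] True that cdim by (force simp: kcells_def)
    then have "partly_split d (n + 1) P L f"
      using cdim lefschetz Morse_Bott finite matching cdim_pair pair_cells incidence_pair dim_on_pairs
      by unfold_locales auto
    then show ?thesis by (intro exI[of _ P] exI[of _ L]) simp
  next
    case False
    then obtain \<kappa> where \<kappa>: "\<kappa> \<in> cells L" "d \<kappa> = n" "\<kappa> \<notin> pair_cells P"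
      using cdim by (auto simp: kcells_def)
    show ?thesis
    proof (cases "\<exists>\<mu>\<in>cells L. incidence L \<mu> \<kappa> \<noteq> 0")
      case True
      then obtain \<mu> where \<mu>: "\<mu> \<in> cells L" "incidence L \<mu> \<kappa> \<noteq> 0" by blast
      let ?S = "split_off L \<mu> \<kappa>" and ?P = "insert (\<mu>, \<kappa>) P"
      note step = split_off_step[OF less.prems(2) less.prems(3) \<mu>(1) \<kappa>(1) \<mu>(2) \<kappa>(2,3)]
      have "kcells ?S n - pair_cells ?P \<subset> kcells L n - pair_cells P"
      proof
        show "kcells ?S n - pair_cells ?P \<subseteq> kcells L n - pair_cells P"
          unfolding kcells_split_off[OF lefschetz \<mu>(1) \<kappa>(1) \<mu>(2)] pair_cells_insert by blast
        have "\<kappa> \<in> kcells L n - pair_cells P" "\<kappa> \<notin> kcells ?S n - pair_cells ?P"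
          using \<kappa> cdim by (simp_all add: kcells_def pair_cells_insert)
        then show "kcells ?S n - pair_cells ?P \<noteq> kcells L n - pair_cells P" by blast
      qed
      then have smaller: "card (kcells ?S n - pair_cells ?P) < card (kcells L n - pair_cells P)"
        by (rule psubset_card_mono[OF fin])
      have "\<forall>\<sigma>\<in>cells ?S. d \<sigma> \<le> n + 1 \<longrightarrow> f \<sigma> = real (d \<sigma>)"
        using less.prems(3) cells_split_off[OF lefschetz \<mu>(1) \<kappa>(1) \<mu>(2)] by simp
      from less.hyps[OF smaller step(2,3) this]
      obtain P' L' where *: "move\<^sup>*\<^sup>* (?S, f) (L', f)" "partly_split d (n + 1) P' L' f"
        "?P \<subseteq> P'" "\<forall>(\<mu>, \<kappa>)\<in>P' - ?P. d \<kappa> = n" "R_series L' f = R_series ?S f"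
        by (elim exE conjE)
      show ?thesis
      proof (intro exI[of _ P'] exI[of _ L'] conjI)
        show "move\<^sup>*\<^sup>* (L, f) (L', f)" using step(1) *(1) by (rule converse_rtranclp_into_rtranclp)
        show "\<forall>(\<mu>, \<kappa>)\<in>P' - P. d \<kappa> = n" using *(4) \<kappa>(2) by auto
      qed (use * step(4) in auto)
    next
      case False
      have "isolated_cell L \<kappa>"
        unfolding isolated_cell_def
      proof (intro conjI ballI)
        fix \<sigma> assume \<sigma>: "\<sigma> \<in> cells L"
        then show "incidence L \<sigma> \<kappa> = 0" using False by blast
        show "incidence L \<kappa> \<sigma> = 0"
        proof (rule ccontr)
          assume w: "incidence L \<kappa> \<sigma> \<noteq> 0"
          then have "d \<sigma> < n" using lefschetz_cdim[OF lefschetz \<kappa>(1) \<sigma> w] \<kappa>(2) cdim by simp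
          then have "\<sigma> \<in> pair_cells P" using cdim_rest[OF \<sigma>] by force
          then have "(\<kappa>, \<sigma>) \<in> P" using incident_in_pairs(1)[OF \<kappa>(1) \<sigma> w] by blast
          then show False using \<kappa>(3) pair_cellsI(1) by metis
        qed
      qed (rule \<kappa>(1))
      note step = remove_step[OF less.prems(2) this \<kappa>(2,3)]
      have "kcells (remove_cell L \<kappa>) n - pair_cells P \<subset> kcells L n - pair_cells P"
      proof
        show "kcells (remove_cell L \<kappa>) n - pair_cells P \<subseteq> kcells L n - pair_cells P"
          unfolding kcells_remove_cell by blast
        have "\<kappa> \<in> kcells L n - pair_cells P" "\<kappa> \<notin> kcells (remove_cell L \<kappa>) n - pair_cells P"
          using \<kappa> cdim by (simp_all add: kcells_def)
        then show "kcells (remove_cell L \<kappa>) n - pair_cells P \<noteq> kcells L n - pair_cells P" by blast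
      qed
      then have smaller: "card (kcells (remove_cell L \<kappa>) n - pair_cells P) < card (kcells L n - pair_cells P)"
        by (rule psubset_card_mono[OF fin])
      have "\<forall>\<sigma>\<in>cells (remove_cell L \<kappa>). d \<sigma> \<le> n + 1 \<longrightarrow> f \<sigma> = real (d \<sigma>)"
        using less.prems(3) by simp
      from less.hyps[OF smaller step(2,3) this]
      obtain P' L' where *: "move\<^sup>*\<^sup>* (remove_cell L \<kappa>, f) (L', f)"
        "partly_split d (n + 1) P' L' f" "P \<subseteq> P'" "\<forall>(\<mu>, \<kappa>)\<in>P' - P. d \<kappa> = n"
        "R_series L' f = R_series (remove_cell L \<kappa>) f"
        by (elim exE conjE)
      have "move\<^sup>*\<^sup>* (L, f) (L', f)" using step(1) *(1) by (rule converse_rtranclp_into_rtranclp)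
      then show ?thesis using * step(4) by (intro exI[of _ P'] exI[of _ L']) simp
    qed
  qed
qed

text \<open>One stage of the construction.  Pairs are cancelled in degree \<open>n + 1\<close> as well as in degree
  \<open>n\<close>, because Move (III) preserves comparisons, whereas a constant value on the cells of dimension
  \<open>n + 1\<close> compares in the same way with all faces of a cell of dimension \<open>n + 2\<close>.\<close>

lemma partly_split_step:
  assumes "partly_split d n P L f"
  shows "\<exists>P' L' f'. move\<^sup>*\<^sup>* (L, f) (L', f') \<and> partly_split d (n + 1) P' L' f' \<and> P \<subseteq> P' \<and>
    (\<forall>(\<mu>, \<kappa>)\<in>P' - P. d \<kappa> = n) \<and> R_series L' f' = R_series L f"
proof -
  obtain L1 where 1: "move\<^sup>*\<^sup>* (L, f) (L1, f)" "partly_split d n P L1 f" "increasing_upto L1 f (n + 1)"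
    "R_series L1 f = R_series L f"
    using cancel_all_in_degree[OF assms partly_split.increasing[OF assms]] by blast
  obtain L2 where 2: "move\<^sup>*\<^sup>* (L1, f) (L2, f)" "partly_split d n P L2 f" "increasing_upto L2 f (n + 2)"
    "R_series L2 f = R_series L1 f"
    using cancel_all_in_degree[OF 1(2,3)] by auto
  obtain g where 3: "move (L2, f) (L2, g)" "partly_split d n P L2 g" "increasing_upto L2 g (n + 2)"
    "\<forall>\<sigma>\<in>cells L2. d \<sigma> \<le> n + 1 \<longrightarrow> g \<sigma> = real (d \<sigma>)" "R_series L2 g = R_series L2 f"
    using normalize_function[OF 2(2,3)] by blast
  obtain P' L' where 4: "move\<^sup>*\<^sup>* (L2, g) (L', g)" "partly_split d (n + 1) P' L' g" "P \<subseteq> P'"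
    "\<forall>(\<mu>, \<kappa>)\<in>P' - P. d \<kappa> = n" "R_series L' g = R_series L2 g"
    using split_off_degree[OF 3(2-4)] by blast
  have "move\<^sup>*\<^sup>* (L, f) (L', g)" using 1(1) 2(1) 3(1) 4(1) by (meson rtranclp.rtrancl_into_rtrancl rtranclp_trans)
  moreover have "R_series L' g = R_series L f" using 1(4) 2(4) 3(5) 4(5) by simp
  ultimately show ?thesis using 4(2-4) by (intro exI[of _ P'] exI[of _ L'] exI[of _ g]) simp
qed

section \<open>Complexes of blocks\<close>

definition block_complex :: "('a \<Rightarrow> nat) \<Rightarrow> ('a \<times> 'a) set \<Rightarrow> 'a complex_data" where
  "block_complex d P =
     \<lparr>cells = pair_cells P, cdim = d, incidence = (\<lambda>\<tau> \<sigma>. if (\<tau>, \<sigma>) \<in> P then 1 else 0)\<rparr>"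

lemma block_complex_simps [simp]:
  "cells (block_complex d P) = pair_cells P" "cdim (block_complex d P) = d"
  "incidence (block_complex d P) \<tau> \<sigma> = (if (\<tau>, \<sigma>) \<in> P then 1 else 0)"
  by (simp_all add: block_complex_def)

lemma matching_unique:
  "matching P \<Longrightarrow> p \<in> P \<Longrightarrow> q \<in> P \<Longrightarrow> x \<in> {fst p, snd p} \<Longrightarrow> x \<in> {fst q, snd q} \<Longrightarrow> p = q"
  unfolding matching_def by blast

context
  fixes d :: "'a \<Rightarrow> nat" and P :: "('a \<times> 'a) set"
  assumes match: "matching P" and graded: "\<And>\<mu> \<kappa>. (\<mu>, \<kappa>) \<in> P \<Longrightarrow> d \<mu> = d \<kappa> + 1"
begin

lemma matching_no_path: "(\<tau>, \<sigma>) \<in> P \<Longrightarrow> (\<sigma>, \<nu>) \<in> P \<Longrightarrow> False"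
  using matching_unique[OF match, of "(\<tau>, \<sigma>)" "(\<sigma>, \<nu>)" \<sigma>] graded[of \<tau> \<sigma>] by auto

lemma disjoint_union_of_blocks_block_complex: "disjoint_union_of_blocks (block_complex d P)"
  unfolding disjoint_union_of_blocks_def
proof (intro exI[of _ P] conjI)
  show "P \<subseteq> {(\<mu>, \<kappa>). \<mu> \<in> cells (block_complex d P) \<and> \<kappa> \<in> cells (block_complex d P) \<and>
      cdim (block_complex d P) \<mu> = cdim (block_complex d P) \<kappa> + 1}"
    using graded by (auto dest: pair_cellsI)
  show "is_disjoint_union (block_complex d P) P
      (\<lambda>(\<mu>, \<kappa>). elementary_block (cdim (block_complex d P)) \<mu> \<kappa>)"
    unfolding is_disjoint_union_def
  proof (intro conjI ballI)
    show "disjoint_family_on (\<lambda>p. cells (case p of (\<mu>, \<kappa>) \<Rightarrow>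
        elementary_block (cdim (block_complex d P)) \<mu> \<kappa>)) P"
      using match by (simp add: disjoint_family_on_def matching_def elementary_block_def case_prod_beta)
    show "cells (block_complex d P) = (\<Union>p\<in>P. cells (case p of (\<mu>, \<kappa>) \<Rightarrow>
        elementary_block (cdim (block_complex d P)) \<mu> \<kappa>))"
      by (force simp: pair_cells_def elementary_block_def split: prod.splits)
    show "cdim (block_complex d P) \<sigma> =
        cdim (case p of (\<mu>, \<kappa>) \<Rightarrow> elementary_block (cdim (block_complex d P)) \<mu> \<kappa>) \<sigma>" for p \<sigma>
      by (simp add: elementary_block_def split: prod.splits)
    fix p q \<tau> \<sigma> assume pq: "p \<in> P" "q \<in> P"
      and "\<tau> \<in> cells (case p of (\<mu>, \<kappa>) \<Rightarrow> elementary_block (cdim (block_complex d P)) \<mu> \<kappa>)"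
      and "\<sigma> \<in> cells (case q of (\<mu>, \<kappa>) \<Rightarrow> elementary_block (cdim (block_complex d P)) \<mu> \<kappa>)"
    then have \<tau>: "\<tau> \<in> {fst p, snd p}" and \<sigma>: "\<sigma> \<in> {fst q, snd q}"
      by (auto simp: elementary_block_def split: prod.splits)
    have "(\<tau>, \<sigma>) \<in> P \<longleftrightarrow> p = q \<and> p = (\<tau>, \<sigma>)"
      using matching_unique[OF match _ pq(1) _ \<tau>, of "(\<tau>, \<sigma>)"]
        matching_unique[OF match _ pq(2) _ \<sigma>, of "(\<tau>, \<sigma>)"] pq by auto
    then show "incidence (block_complex d P) \<tau> \<sigma> = (if p = q then
        incidence (case p of (\<mu>, \<kappa>) \<Rightarrow> elementary_block (cdim (block_complex d P)) \<mu> \<kappa>) \<tau> \<sigma> else 0)"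
      by (auto simp: elementary_block_def split: prod.splits)
  qed
qed

lemma lefschetz_block_complex:
  assumes "\<And>k. finite (kcells (block_complex d P) k)"
  shows "lefschetz_complex (block_complex d P)"
  unfolding lefschetz_complex_iff
proof (intro conjI allI ballI impI)
  show "(\<Sum>\<sigma>\<in>kcells (block_complex d P) k. incidence (block_complex d P) \<tau> \<sigma> *
      incidence (block_complex d P) \<sigma> \<nu>) = 0" for k \<tau> \<nu>
    using matching_no_path by (intro sum.neutral) auto
qed (use assms graded in \<open>auto split: if_splits\<close>)

end

definition unsplit_part :: "'a complex_data \<Rightarrow> ('a \<times> 'a) set \<Rightarrow> 'a complex_data" where
  "unsplit_part L P = L\<lparr>cells := cells L - pair_cells P\<rparr>"

lemma unsplit_part_simps [simp]:
  "cells (unsplit_part L P) = cells L - pair_cells P" "cdim (unsplit_part L P) = cdim L"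
  "incidence (unsplit_part L P) = incidence L"
  by (simp_all add: unsplit_part_def)

abbreviation join :: "('a \<Rightarrow> nat) \<Rightarrow> ('a \<times> 'a) set \<Rightarrow> 'a complex_data \<Rightarrow> 'a complex_data" where
  "join d P M \<equiv> block_complex d P \<squnion>\<^sub>c M"

abbreviation join_fun :: "('a \<Rightarrow> nat) \<Rightarrow> ('a \<times> 'a) set \<Rightarrow> ('a \<Rightarrow> real) \<Rightarrow> 'a \<Rightarrow> real" where
  "join_fun d P f \<equiv> fun_union (block_complex d P) (dim_fun (block_complex d P)) f"

lemma cells_join: "cells (join d P M) = pair_cells P \<union> cells M"
  and cdim_join: "cdim M = d \<Longrightarrow> cdim (join d P M) = d"
  and incidence_join: "incidence (join d P M) \<tau> \<sigma> =
    (if \<tau> \<in> pair_cells P \<and> \<sigma> \<in> pair_cells P then if (\<tau>, \<sigma>) \<in> P then 1 else 0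
     else if \<tau> \<in> cells M \<and> \<sigma> \<in> cells M then incidence M \<tau> \<sigma> else 0)"
  by (auto simp: disj_union_def)

lemma join_fun_eq: "join_fun d P f \<sigma> = (if \<sigma> \<in> pair_cells P then real (d \<sigma>) else f \<sigma>)"
  by (simp add: fun_union_def dim_fun_def)

lemma partly_split_cong:
  assumes "partly_split d n P L f" and same: "same_complex L L'" and "cdim L' = d"
    and f: "\<And>\<sigma>. \<sigma> \<in> cells L \<Longrightarrow> f \<sigma> = f' \<sigma>"
  shows "partly_split d n P L' f'"
proof -
  interpret partly_split d n P L f by fact
  note cells = same_complex_cells[OF same]
  have "discrete_Morse_Bott L f \<longleftrightarrow> discrete_Morse_Bott L' f'"
    by (rule discrete_Morse_Bott_cong[OF same]) (simp add: f)
  then show ?thesis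
    using lefschetz Morse_Bott assms(3) lefschetz_complex_cong[OF same] finite matching cdim_pair
      pair_cells incidence_pair incidence_cong[OF same] dim_on_pairs f cdim_rest
    by unfold_locales (auto simp: cells[symmetric] subset_iff)
qed

context partly_split
begin

lemma same_complex_join: "same_complex L (join d P (unsplit_part L P))"
proof (rule same_complexI)
  show "cells L = cells (join d P (unsplit_part L P))" using pair_cells by (auto simp: cells_join)
  show "cdim L \<sigma> = cdim (join d P (unsplit_part L P)) \<sigma>" for \<sigma>
    by (simp add: cdim cdim_join)
  fix \<tau> \<sigma> assume "\<tau> \<in> cells (join d P (unsplit_part L P))" "\<sigma> \<in> cells (join d P (unsplit_part L P))"
  then have c: "\<tau> \<in> cells L" "\<sigma> \<in> cells L" using pair_cells by (auto simp: cells_join)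
  then show "incidence L \<tau> \<sigma> = incidence (join d P (unsplit_part L P)) \<tau> \<sigma>"
    using incidence_pair[OF c] pair_cellsI[of \<tau> \<sigma> P] by (auto simp: incidence_join)
qed

lemma join_fun_agrees: "f \<sigma> = join_fun d P f \<sigma>"
  by (simp add: join_fun_eq dim_on_pairs)

lemma lefschetz_unsplit_part: "lefschetz_complex (unsplit_part L P)" (is "lefschetz_complex ?M")
  unfolding lefschetz_complex_iff
proof (intro conjI allI ballI impI)
  have sub: "kcells ?M k \<subseteq> kcells L k" for k by (auto simp: kcells_def)
  show "finite (kcells ?M k)" for k
    using finite_subset[OF sub finite_kcells[OF lefschetz]] .
  show "cdim ?M \<tau> = cdim ?M \<sigma> + 1"
    if "\<tau> \<in> cells ?M" "\<sigma> \<in> cells ?M" "incidence ?M \<tau> \<sigma> \<noteq> 0" for \<tau> \<sigma>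
    using that lefschetz_cdim[OF lefschetz, of \<tau> \<sigma>] by simp
  fix \<tau> \<nu> k assume c: "\<tau> \<in> cells ?M" "\<nu> \<in> cells ?M"
  have "(\<Sum>\<sigma>\<in>kcells ?M k. incidence ?M \<tau> \<sigma> * incidence ?M \<sigma> \<nu>) =
      (\<Sum>\<sigma>\<in>kcells L k. incidence L \<tau> \<sigma> * incidence L \<sigma> \<nu>)"
  proof (intro sum.mono_neutral_cong_left finite_kcells[OF lefschetz] sub ballI refl)
    fix \<sigma> assume "\<sigma> \<in> kcells L k - kcells ?M k"
    then have "\<sigma> \<in> cells L" "\<sigma> \<in> pair_cells P" by (auto simp: kcells_def)
    then have "incidence L \<tau> \<sigma> = 0"
      using incident_in_pairs(1)[of \<tau> \<sigma>] pair_cellsI(1)[of \<tau> \<sigma> P] c by auto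
    then show "incidence L \<tau> \<sigma> * incidence L \<sigma> \<nu> = 0" by simp
  qed simp
  then show "(\<Sum>\<sigma>\<in>kcells ?M k. incidence ?M \<tau> \<sigma> * incidence ?M \<sigma> \<nu>) = 0"
    using lefschetz_square[OF lefschetz, of \<tau> \<nu> k] c by simp
qed

lemma Morse_Bott_unsplit_part: "discrete_Morse_Bott (unsplit_part L P) f"
  by (rule discrete_Morse_Bott_subset[OF lefschetz Morse_Bott lefschetz_unsplit_part]) auto

lemma partly_split_join:
  "partly_split d n P (join d P (unsplit_part L P)) (join_fun d P f)"
  using partly_split_cong[OF partly_split_axioms same_complex_join] join_fun_agrees cdim
  by (simp add: cdim_join)

lemma R_series_join:
  "R_series (join d P (unsplit_part L P)) (join_fun d P f) = R_series L f"
  using R_series_cong[OF same_complex_join _ lefschetz, of f "join_fun d P f"] join_fun_agrees by simp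

end

section \<open>The recursive construction\<close>

theorem theorem1p2:
  fixes K :: "'a complex_data" and f :: "'a \<Rightarrow> real"
  assumes "lefschetz_complex K" and "discrete_Morse_Bott K f"
  shows "\<exists>E :: 'a complex_data.
    lefschetz_complex E \<and> constructed_recursively K f E \<and>
    disjoint_union_of_blocks E \<and> R_series K f = R_series E (dim_fun E)"
proof -
  define d where "d = cdim K"
  \<comment> \<open>A state consists of the pairs already split off, the remaining complex and its function.  The
    last conjunct makes the sequence chosen below start at \<open>(K, f)\<close>.\<close>
  define inv where "inv n s = (case s of (P, M, g) \<Rightarrow>
    partly_split d n P (join d P M) (join_fun d P g) \<and> cdim M = d \<and>
    lefschetz_complex M \<and> discrete_Morse_Bott M g \<and> pair_cells P \<inter> cells M = {} \<and>
    R_series (join d P M) (join_fun d P g) = R_series K f \<and>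
    (n = 0 \<longrightarrow> s = ({}, K, f)))" for n :: nat and s :: "('a \<times> 'a) set \<times> 'a complex_data \<times> ('a \<Rightarrow> real)"
  define step where "step n s s' = (case (s, s') of ((P, M, g), (P', M', g')) \<Rightarrow>
    P \<subseteq> P' \<and> (\<forall>(\<mu>, \<kappa>)\<in>P' - P. d \<kappa> = n) \<and>
    obtained_by_moves (join d P M, join_fun d P g) (join d P' M', join_fun d P' g'))"
    for n :: nat and s s' :: "('a \<times> 'a) set \<times> 'a complex_data \<times> ('a \<Rightarrow> real)"
  have "\<exists>s. inv 0 s"
  proof -
    have [simp]: "pair_cells {} = {}" by (simp add: pair_cells_def)
    interpret partly_split d 0 "{}" K f
      using assms by unfold_locales (auto simp: d_def matching_def)
    have eq: "unsplit_part K {} = K" by (simp add: unsplit_part_def)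
    have "inv 0 ({}, K, f)"
      using partly_split_join[unfolded eq] R_series_join[unfolded eq] assms
      by (simp add: inv_def d_def)
    then show ?thesis ..
  qed
  moreover have "\<exists>s'. inv (Suc n) s' \<and> step n s s'" if "inv n s" for n s
  proof -
    obtain P M g where s: "s = (P, M, g)" by (cases s)
    have inv: "partly_split d n P (join d P M) (join_fun d P g)"
      "R_series (join d P M) (join_fun d P g) = R_series K f"
      using that by (simp_all add: inv_def s)
    obtain P' L' g' where *: "move\<^sup>*\<^sup>* (join d P M, join_fun d P g) (L', g')"
      "partly_split d (n + 1) P' L' g'" "P \<subseteq> P'" "\<forall>(\<mu>, \<kappa>)\<in>P' - P. d \<kappa> = n"
      "R_series L' g' = R_series (join d P M) (join_fun d P g)"
      using partly_split_step[OF inv(1)] by (elim exE conjE)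
    interpret L': partly_split d "n + 1" P' L' g' by (rule *(2))
    let ?M = "unsplit_part L' P'"
    have "inv (Suc n) (P', ?M, g')"
      using L'.partly_split_join L'.cdim L'.lefschetz_unsplit_part L'.Morse_Bott_unsplit_part
        L'.R_series_join *(5) inv(2) by (auto simp: inv_def)
    moreover have "step n s (P', ?M, g')"
      unfolding step_def s obtained_by_moves_def
      using *(1,3,4) L'.same_complex_join L'.join_fun_agrees
      by (simp only: prod.case fst_conv snd_conv) blast
    ultimately show ?thesis by blast
  qed
  ultimately obtain s where s: "\<And>n. inv n (s n)" "\<And>n. step n (s n) (s (Suc n))"
    using dependent_nat_choice[of inv step] by blast
  define P M g where "P n = fst (s n)" and "M n = fst (snd (s n))" and "g n = snd (snd (s n))" for n
  have s_eq: "s n = (P n, M n, g n)" for n by (simp add: P_def M_def g_def)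
  have split: "partly_split d n (P n) (join d (P n) (M n)) (join_fun d (P n) (g n))"
    and cdim_M: "cdim (M n) = d"
    and M: "lefschetz_complex (M n)" "discrete_Morse_Bott (M n) (g n)"
    and disj: "pair_cells (P n) \<inter> cells (M n) = {}"
    and R: "R_series (join d (P n) (M n)) (join_fun d (P n) (g n)) = R_series K f" for n
    using s(1)[of n] by (simp_all add: inv_def s_eq)
  have init: "P 0 = {}" "M 0 = K" "g 0 = f"
    using s(1)[of 0] by (simp_all add: inv_def s_eq)
  have P_Suc: "P n \<subseteq> P (Suc n)" and new: "\<And>\<mu> \<kappa>. (\<mu>, \<kappa>) \<in> P (Suc n) \<Longrightarrow> (\<mu>, \<kappa>) \<notin> P n \<Longrightarrow> d \<kappa> = n"
    and moves: "obtained_by_moves (join d (P n) (M n), join_fun d (P n) (g n))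
      (join d (P (Suc n)) (M (Suc n)), join_fun d (P (Suc n)) (g (Suc n)))" for n
    using s(2)[of n] by (auto simp: step_def s_eq)
  have P_mono: "P m \<subseteq> P n" if "m \<le> n" for m n
    using lift_Suc_mono_le[of P] P_Suc that by blast
  have match: "matching (P n)" and graded: "\<And>\<mu> \<kappa>. (\<mu>, \<kappa>) \<in> P n \<Longrightarrow> d \<mu> = d \<kappa> + 1"
    and fin: "finite (P n)" for n
    using split[of n] by (auto simp: partly_split_def)
  define Q where "Q = (\<Union>n. P n)"
  have P_Q: "P n \<subseteq> Q" for n by (auto simp: Q_def)
  have Q_graded: "d \<mu> = d \<kappa> + 1" if "(\<mu>, \<kappa>) \<in> Q" for \<mu> \<kappa>
    using that graded by (auto simp: Q_def)
  have Q_match: "matching Q"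
    unfolding matching_def
  proof (intro ballI impI)
    fix p q assume "p \<in> Q" "q \<in> Q" "p \<noteq> q"
    then obtain m n where "p \<in> P m" "q \<in> P n" by (auto simp: Q_def)
    then have "p \<in> P (max m n)" "q \<in> P (max m n)" using P_mono by (meson max.cobounded1 max.cobounded2 subsetD)+
    then show "{fst p, snd p} \<inter> {fst q, snd q} = {}"
      using match[of "max m n"] \<open>p \<noteq> q\<close> unfolding matching_def by blast
  qed
  \<comment> \<open>Stage \<open>m\<close> only adds pairs with lower cell of dimension \<open>m\<close>, so \<open>P n\<close> contains all pairs
    of the limit whose lower cell has dimension below \<open>n\<close>.\<close>
  have late: "n \<le> d \<kappa>" if "(\<mu>, \<kappa>) \<in> Q" "(\<mu>, \<kappa>) \<notin> P n" for \<mu> \<kappa> n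
  proof -
    from that(1) obtain m where "(\<mu>, \<kappa>) \<in> P m" by (auto simp: Q_def)
    then show ?thesis
    proof (induction m)
      case 0 then show ?case by (simp add: init)
    next
      case (Suc m)
      show ?case
      proof (cases "(\<mu>, \<kappa>) \<in> P m")
        case False
        have "n \<le> m"
        proof (rule ccontr)
          assume "\<not> n \<le> m"
          then have "P (Suc m) \<subseteq> P n" by (intro P_mono) simp
          then show False using Suc.prems that(2) by blast
        qed
        then show ?thesis using new[OF Suc.prems False] by simp
      qed (rule Suc.IH)
    qed
  qed
  have Q_P: "(\<tau>, \<sigma>) \<in> Q \<longleftrightarrow> (\<tau>, \<sigma>) \<in> P n"
    if "\<tau> \<in> pair_cells (P n) \<or> \<sigma> \<in> pair_cells (P n)" for \<tau> \<sigma> n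
  proof
    assume Q: "(\<tau>, \<sigma>) \<in> Q"
    from that obtain p where p: "p \<in> P n" "\<tau> \<in> {fst p, snd p} \<or> \<sigma> \<in> {fst p, snd p}"
      unfolding pair_cells_def by blast
    then have "p = (\<tau>, \<sigma>)" using matching_unique[OF Q_match _ Q, of p] P_Q by auto
    then show "(\<tau>, \<sigma>) \<in> P n" using p by simp
  qed (use P_Q in blast)
  define E where "E = block_complex d Q"
  have low_cells: "\<sigma> \<in> pair_cells (P (Suc k))" if "\<sigma> \<in> pair_cells Q" "d \<sigma> \<le> k" for \<sigma> k
  proof -
    from that(1) obtain \<mu> \<kappa> where p: "(\<mu>, \<kappa>) \<in> Q" "\<sigma> = \<mu> \<or> \<sigma> = \<kappa>"
      by (rule pair_cellsE)
    then have "(\<mu>, \<kappa>) \<in> P (Suc k)" using late[OF p(1), of "Suc k"] Q_graded[OF p(1)] that(2) by fastforce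
    then show ?thesis using p(2) pair_cellsI by metis
  qed
  have E: "lefschetz_complex E"
    unfolding E_def
  proof (rule lefschetz_block_complex[OF Q_match Q_graded])
    fix k
    have "kcells (block_complex d Q) k \<subseteq> pair_cells (P (Suc k))"
      using low_cells by (auto simp: kcells_def)
    moreover have "finite (pair_cells (P (Suc k)))" using fin by (simp add: pair_cells_def)
    ultimately show "finite (kcells (block_complex d Q) k)" by (rule finite_subset)
  qed
  have blocks: "disjoint_union_of_blocks E"
    unfolding E_def by (rule disjoint_union_of_blocks_block_complex[OF Q_match Q_graded])
  have "constructed_recursively K f E"
    unfolding constructed_recursively_def
  proof (rule exI[of _ "\<lambda>n. block_complex d (P n)"], rule exI[of _ M], rule exI[of _ g],
      intro conjI allI ballI)
    fix n
    have "finite (pair_cells (P n))" using fin by (simp add: pair_cells_def)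
    then show "finite (cells (block_complex d (P n)))" by simp
    then have kcells: "finite (kcells (block_complex d (P n)) k)" for k
      using finite_subset[OF kcells_subset] by blast
    show "lefschetz_complex (block_complex d (P n))"
      by (rule lefschetz_block_complex[OF match graded kcells])
    show "disjoint_union_of_blocks (block_complex d (P n))"
      by (rule disjoint_union_of_blocks_block_complex[OF match graded])
    show "n \<le> cdim (M n) \<sigma>" if "\<sigma> \<in> cells (M n)" for \<sigma>
      using partly_split.cdim_rest[OF split[of n], of \<sigma>] that disj[of n] cdim_M by (auto simp: cells_join)
    have "(\<tau>, \<sigma>) \<in> P (Suc n) \<longleftrightarrow> (\<tau>, \<sigma>) \<in> P n" if "\<tau> \<in> pair_cells (P n)" for \<tau> \<sigma>
      using Q_P[of \<tau> n \<sigma>] that P_Suc[of n] P_Q[of "Suc n"] by blast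
    then show "subcomplex (block_complex d (P n)) (block_complex d (P (Suc n)))"
      using pair_cells_mono[OF P_Suc[of n]] by (auto simp: subcomplex_def)
    show "subcomplex (block_complex d (P n)) E"
      using pair_cells_mono[OF P_Q[of n]] Q_P[of _ n] by (auto simp: subcomplex_def E_def)
    show "cdim (block_complex d (P (Suc n))) \<sigma> \<in> {n, n + 1}"
      if \<sigma>: "\<sigma> \<in> cells (block_complex d (P (Suc n))) - cells (block_complex d (P n))" for \<sigma>
    proof -
      obtain \<mu> \<kappa> where p: "(\<mu>, \<kappa>) \<in> P (Suc n)" "\<sigma> = \<mu> \<or> \<sigma> = \<kappa>"
        using \<sigma> by (auto elim: pair_cellsE)
      then have "(\<mu>, \<kappa>) \<notin> P n" using \<sigma> pair_cellsI[of \<mu> \<kappa> "P n"] by auto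
      then show ?thesis using new[OF p(1)] graded[OF p(1)] p(2) by auto
    qed
  qed (use M moves disj init in \<open>auto simp: E_def Q_def pair_cells_def\<close>)
  moreover have "R_series K f = R_series E (dim_fun E)"
  proof (rule fps_ext)
    fix j
    \<comment> \<open>After stage \<open>j\<close> all cells of dimension at most \<open>j\<close> lie in blocks, so in degree \<open>j\<close> the
      remainder is a plain boundary rank, and the boundary map is already that of \<open>E\<close>.\<close>
    let ?L = "join d (P (Suc j)) (M (Suc j))"
    interpret L: partly_split d "Suc j" "P (Suc j)" ?L "join_fun d (P (Suc j)) (g (Suc j))"
      by (rule split)
    have "fps_nth (R_series K f) j = int (dim (boundaries ?L j))"
      using R_series_nth_increasing[OF L.lefschetz L.increasing, of j] R by simp
    moreover have "increasing_upto E (dim_fun E) (Suc j)"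
      using Q_graded by (auto simp: increasing_upto_def E_def dim_fun_def split: if_splits)
    then have "fps_nth (R_series E (dim_fun E)) j = int (dim (boundaries E j))"
      using R_series_nth_increasing[OF E] by blast
    moreover have "dim (boundaries ?L j) = dim (boundaries E j)"
    proof -
      let ?A = "kcells ?L (j + 1)" and ?A' = "kcells E (j + 1)" and ?B = "kcells E j"
      let ?w = "incidence E"
      have in_pairs: "\<sigma> \<in> pair_cells (P (Suc j))" if "\<sigma> \<in> kcells ?L j" for \<sigma>
        using that L.cdim_rest[of \<sigma>] L.cdim by (force simp: mem_kcells)
      have in_pairs_E: "\<sigma> \<in> pair_cells (P (Suc j))" if "\<sigma> \<in> ?B" for \<sigma>
        using that low_cells[of \<sigma> j] by (simp add: mem_kcells E_def)
      have B: "kcells ?L j = ?B"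
        using in_pairs in_pairs_E pair_cells_mono[OF P_Q] L.cdim
        by (auto simp: kcells_def cells_join E_def)
      have w: "incidence ?L \<tau> \<sigma> = ?w \<tau> \<sigma>" if "\<tau> \<in> ?A" "\<sigma> \<in> ?B" for \<tau> \<sigma>
      proof -
        have "\<sigma> \<in> kcells ?L j" using that(2) by (simp only: B)
        then have "\<tau> \<in> cells ?L" "\<sigma> \<in> cells ?L" using that(1) by (simp_all add: kcells_def)
        then show ?thesis
          using L.incidence_pair[of \<tau> \<sigma>] in_pairs_E[OF that(2)] Q_P[of \<tau> "Suc j" \<sigma>]
          by (simp add: E_def)
      qed
      \<comment> \<open>The two complexes may have different \<open>(j + 1)\<close>-cells, but those with nonzero boundary
        agree.\<close>
      have both: "\<tau> \<in> ?A \<inter> ?A'" if "(\<tau>, \<sigma>) \<in> Q" "\<sigma> \<in> ?B" for \<tau> \<sigma>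
      proof -
        have "(\<tau>, \<sigma>) \<in> P (Suc j)" using Q_P in_pairs_E[OF that(2)] that(1) by blast
        then have "\<tau> \<in> pair_cells (P (Suc j))" "\<tau> \<in> pair_cells Q"
          using that(1) by (simp_all add: pair_cellsI)
        moreover have "d \<tau> = j + 1" using Q_graded[OF that(1)] that(2) by (simp add: kcells_def E_def)
        ultimately show ?thesis using L.cdim by (simp add: kcells_def cells_join E_def)
      qed
      have zero: "?w \<tau> \<sigma> = 0" if "\<tau> \<notin> ?A \<inter> ?A'" "\<sigma> \<in> ?B" for \<tau> \<sigma>
      proof -
        have "(\<tau>, \<sigma>) \<notin> Q" using both that by blast
        then show ?thesis by (simp add: E_def)
      qed
      have "incidence_rank (incidence ?L) ?A ?B = incidence_rank ?w ?A ?B"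
        by (rule incidence_rank_cong) (rule w)
      also have "\<dots> = incidence_rank ?w (?A \<inter> ?A') ?B"
        by (rule incidence_rank_nonzero_rows) (use zero in blast)+
      also have "\<dots> = incidence_rank ?w ?A' ?B"
        by (rule incidence_rank_nonzero_rows[symmetric]) (use zero in blast)+
      finally show ?thesis
        using B by (simp add: dim_boundaries finite_kcells L.lefschetz E)
    qed
    ultimately show "fps_nth (R_series K f) j = fps_nth (R_series E (dim_fun E)) j" by simp
  qed
  ultimately show ?thesis using E blocks by blast
qed

end
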